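(* Let $m,n$ be non-negative integers with $(m,n)\neq(0,0)$ and let $R$ be a $2$-primal $(m,n)$-regularly nil clean ring. Then for all non-negative integers $p,q$ and every positive integer $k$, the matrix ring $\mathrm{M}_k(R)$ is $(p,q)$-regularly nil clean.
   Context: All rings are associative with identity (not necessarily commutative). For non-negative integers $m,n$, a ring $R$ is called $(m,n)$-regularly nil clean if for every $a\in R$ there exists an idempotent $e\in a^mRa^n$ such that $a^m(1-e)a^n$ is nilpotent (with the convention $a^0=1$). A ring $R$ is called $2$-primal if its set of nilpotent elements equals its prime radical, i.e. the intersection of all prime ideals of $R$. *)

theory Defs
  imports "HOL-Algebra.Ideal_Product" "Jordan_Normal_Form.Matrix"
begin

(* HOL-Algebra's locale "ring" is used throughout: associative with identity,
   not necessarily commutative, and the zero ring is allowed. *)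

definition nilpotents :: "('a, 'b) ring_scheme \<Rightarrow> 'a set" where
  "nilpotents R = {x \<in> carrier R. \<exists>n::nat. x [^]\<^bsub>R\<^esub> n = \<zero>\<^bsub>R\<^esub>}"

definition idempotents :: "('a, 'b) ring_scheme \<Rightarrow> 'a set" where
  "idempotents R = {e \<in> carrier R. e \<otimes>\<^bsub>R\<^esub> e = e}"

definition regularly_nil_clean :: "nat \<Rightarrow> nat \<Rightarrow> ('a, 'b) ring_scheme \<Rightarrow> bool" where
  "regularly_nil_clean m n R \<longleftrightarrow>
     (\<forall>a \<in> carrier R. \<exists>e \<in> idempotents R.
        (\<exists>r \<in> carrier R. e = a [^]\<^bsub>R\<^esub> m \<otimes>\<^bsub>R\<^esub> r \<otimes>\<^bsub>R\<^esub> a [^]\<^bsub>R\<^esub> n) \<and>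
        a [^]\<^bsub>R\<^esub> m \<otimes>\<^bsub>R\<^esub> (\<one>\<^bsub>R\<^esub> \<ominus>\<^bsub>R\<^esub> e) \<otimes>\<^bsub>R\<^esub> a [^]\<^bsub>R\<^esub> n \<in> nilpotents R)"

(* HOL-Algebra's primeideal is restricted to commutative rings (and is elementwise), so
   prime ideals of a noncommutative ring are defined here by products of two-sided ideals. *)
definition nc_prime_ideal :: "'a set \<Rightarrow> ('a, 'b) ring_scheme \<Rightarrow> bool" where
  "nc_prime_ideal P R \<longleftrightarrow> ideal P R \<and> P \<noteq> carrier R \<and>
     (\<forall>I J. ideal I R \<longrightarrow> ideal J R \<longrightarrow> I \<cdot>\<^bsub>R\<^esub> J \<subseteq> P \<longrightarrow> I \<subseteq> P \<or> J \<subseteq> P)"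

(* Intersecting with the carrier only matters for the zero ring, which has no prime ideals. *)
definition prime_radical :: "('a, 'b) ring_scheme \<Rightarrow> 'a set" where
  "prime_radical R = carrier R \<inter> \<Inter>{P. nc_prime_ideal P R}"

definition two_primal :: "('a, 'b) ring_scheme \<Rightarrow> bool" where
  "two_primal R \<longleftrightarrow> nilpotents R = prime_radical R"

(* The library's ring_mat takes its entries from a type class; here they come from the carrier
   of an arbitrary ring R. *)
definition matrix_ring :: "('a, 'b) ring_scheme \<Rightarrow> nat \<Rightarrow> 'a mat ring" where
  "matrix_ring R k =
     \<lparr> carrier = {A \<in> carrier_mat k k. elements_mat A \<subseteq> carrier R},
       monoid.mult = (\<lambda>A B. mat k k (\<lambda>(i, j). \<Oplus>\<^bsub>R\<^esub>l\<in>{..<k}. A $$ (i, l) \<otimes>\<^bsub>R\<^esub> B $$ (l, j))),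
       one = mat k k (\<lambda>(i, j). if i = j then \<one>\<^bsub>R\<^esub> else \<zero>\<^bsub>R\<^esub>),
       zero = mat k k (\<lambda>_. \<zero>\<^bsub>R\<^esub>),
       add = (\<lambda>A B. mat k k (\<lambda>ij. A $$ ij \<oplus>\<^bsub>R\<^esub> B $$ ij)) \<rparr>"

lemma matrix_ring_carrier_iff:
  "A \<in> carrier (matrix_ring R k) \<longleftrightarrow>
     A \<in> carrier_mat k k \<and> (\<forall>i<k. \<forall>j<k. A $$ (i, j) \<in> carrier R)"
  by (fastforce simp: matrix_ring_def)

lemma (in ring) finsum_swap:
  assumes "finite A" "finite B" "\<And>x y. x \<in> A \<Longrightarrow> y \<in> B \<Longrightarrow> f x y \<in> carrier R"
  shows "(\<Oplus>x\<in>A. \<Oplus>y\<in>B. f x y) = (\<Oplus>y\<in>B. \<Oplus>x\<in>A. f x y)"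
  using assms(1,3)
proof (induction A rule: finite_induct)
  case empty
  then show ?case by (simp add: finsum_zero)
next
  case (insert a A)
  have "(\<Oplus>y\<in>B. \<Oplus>x\<in>insert a A. f x y) = (\<Oplus>y\<in>B. f a y \<oplus> (\<Oplus>x\<in>A. f x y))"
    using insert by (intro finsum_cong') (auto simp: finsum_insert Pi_def)
  also have "\<dots> = (\<Oplus>y\<in>B. f a y) \<oplus> (\<Oplus>y\<in>B. \<Oplus>x\<in>A. f x y)"
    using insert by (intro finsum_addf) (auto simp: Pi_def)
  finally show ?case using insert by (simp add: finsum_insert Pi_def)
qed

lemma (in ring) matrix_ring_is_ring: "ring (matrix_ring R k)"
proof (intro ringI abelian_groupI monoidI)
  let ?M = "matrix_ring R k"
  note iff = matrix_ring_carrier_iff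
  have add_index: "(X \<oplus>\<^bsub>?M\<^esub> Y) $$ (i, j) = X $$ (i, j) \<oplus> Y $$ (i, j)"
    if "i < k" "j < k" for X Y i j
    using that by (simp add: matrix_ring_def)
  have mult_index: "(X \<otimes>\<^bsub>?M\<^esub> Y) $$ (i, j) = (\<Oplus>l\<in>{..<k}. X $$ (i, l) \<otimes> Y $$ (l, j))"
    if "i < k" "j < k" for X Y i j
    using that by (simp add: matrix_ring_def)
  fix A B C
  {
    assume A: "A \<in> carrier ?M"
    show "\<exists>B\<in>carrier ?M. B \<oplus>\<^bsub>?M\<^esub> A = \<zero>\<^bsub>?M\<^esub>"
    proof (rule bexI)
      let ?B = "mat k k (\<lambda>ij. \<ominus> (A $$ ij))"
      show "?B \<in> carrier ?M" using A by (simp add: iff)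
      show "?B \<oplus>\<^bsub>?M\<^esub> A = \<zero>\<^bsub>?M\<^esub>"
        using A unfolding iff by (intro eq_matI) (auto simp: matrix_ring_def l_neg)
    qed
    show "\<zero>\<^bsub>?M\<^esub> \<oplus>\<^bsub>?M\<^esub> A = A"
      using A unfolding iff by (intro eq_matI) (auto simp: matrix_ring_def)
    show "\<one>\<^bsub>?M\<^esub> \<otimes>\<^bsub>?M\<^esub> A = A"
    proof (intro eq_matI)
      fix i j assume "i < dim_row A" "j < dim_col A"
      then have ij: "i < k" "j < k" using A by (auto simp: iff)
      have "(\<Oplus>l\<in>{..<k}. \<one>\<^bsub>?M\<^esub> $$ (i, l) \<otimes> A $$ (l, j))
          = (\<Oplus>l\<in>{..<k}. if i = l then A $$ (l, j) else \<zero>)"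
        using A ij by (intro finsum_cong') (auto simp: iff matrix_ring_def)
      also have "\<dots> = A $$ (i, j)"
        using A ij by (intro finsum_singleton) (auto simp: iff)
      finally show "(\<one>\<^bsub>?M\<^esub> \<otimes>\<^bsub>?M\<^esub> A) $$ (i, j) = A $$ (i, j)"
        using ij by (simp add: matrix_ring_def)
    qed (use A in \<open>auto simp: iff matrix_ring_def\<close>)
    show "A \<otimes>\<^bsub>?M\<^esub> \<one>\<^bsub>?M\<^esub> = A"
    proof (intro eq_matI)
      fix i j assume "i < dim_row A" "j < dim_col A"
      then have ij: "i < k" "j < k" using A by (auto simp: iff)
      have "(\<Oplus>l\<in>{..<k}. A $$ (i, l) \<otimes> \<one>\<^bsub>?M\<^esub> $$ (l, j))
          = (\<Oplus>l\<in>{..<k}. if j = l then A $$ (i, l) else \<zero>)"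
        using A ij by (intro finsum_cong') (auto simp: iff matrix_ring_def)
      also have "\<dots> = A $$ (i, j)"
        using A ij by (intro finsum_singleton) (auto simp: iff)
      finally show "(A \<otimes>\<^bsub>?M\<^esub> \<one>\<^bsub>?M\<^esub>) $$ (i, j) = A $$ (i, j)"
        using ij by (simp add: matrix_ring_def)
    qed (use A in \<open>auto simp: iff matrix_ring_def\<close>)
    assume B: "B \<in> carrier ?M"
    show "A \<oplus>\<^bsub>?M\<^esub> B \<in> carrier ?M" using A B unfolding iff
      by (auto simp: matrix_ring_def)
    show "A \<otimes>\<^bsub>?M\<^esub> B \<in> carrier ?M" using A B unfolding iff
      by (auto simp: matrix_ring_def intro!: finsum_closed)
    show "A \<oplus>\<^bsub>?M\<^esub> B = B \<oplus>\<^bsub>?M\<^esub> A"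
      using A B unfolding iff by (intro eq_matI) (auto simp: matrix_ring_def a_comm)
    assume C: "C \<in> carrier ?M"
    show "A \<oplus>\<^bsub>?M\<^esub> B \<oplus>\<^bsub>?M\<^esub> C = A \<oplus>\<^bsub>?M\<^esub> (B \<oplus>\<^bsub>?M\<^esub> C)"
      using A B C unfolding iff by (intro eq_matI) (auto simp: matrix_ring_def a_assoc)
    show "(A \<oplus>\<^bsub>?M\<^esub> B) \<otimes>\<^bsub>?M\<^esub> C = A \<otimes>\<^bsub>?M\<^esub> C \<oplus>\<^bsub>?M\<^esub> B \<otimes>\<^bsub>?M\<^esub> C"
    proof (intro eq_matI)
      fix i j assume "i < dim_row (A \<otimes>\<^bsub>?M\<^esub> C \<oplus>\<^bsub>?M\<^esub> B \<otimes>\<^bsub>?M\<^esub> C)"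
        "j < dim_col (A \<otimes>\<^bsub>?M\<^esub> C \<oplus>\<^bsub>?M\<^esub> B \<otimes>\<^bsub>?M\<^esub> C)"
      then have ij: "i < k" "j < k" by (auto simp: matrix_ring_def)
      have "(\<Oplus>l\<in>{..<k}. (A \<oplus>\<^bsub>?M\<^esub> B) $$ (i, l) \<otimes> C $$ (l, j))
          = (\<Oplus>l\<in>{..<k}. A $$ (i, l) \<otimes> C $$ (l, j) \<oplus> B $$ (i, l) \<otimes> C $$ (l, j))"
        using A B C ij by (intro finsum_cong') (auto simp: iff add_index l_distr)
      also have "\<dots> = (\<Oplus>l\<in>{..<k}. A $$ (i, l) \<otimes> C $$ (l, j))
          \<oplus> (\<Oplus>l\<in>{..<k}. B $$ (i, l) \<otimes> C $$ (l, j))"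
        using A B C ij by (intro finsum_addf) (auto simp: iff)
      finally show "((A \<oplus>\<^bsub>?M\<^esub> B) \<otimes>\<^bsub>?M\<^esub> C) $$ (i, j)
          = (A \<otimes>\<^bsub>?M\<^esub> C \<oplus>\<^bsub>?M\<^esub> B \<otimes>\<^bsub>?M\<^esub> C) $$ (i, j)"
        using ij by (simp add: add_index mult_index)
    qed (auto simp: matrix_ring_def)
    show "C \<otimes>\<^bsub>?M\<^esub> (A \<oplus>\<^bsub>?M\<^esub> B) = C \<otimes>\<^bsub>?M\<^esub> A \<oplus>\<^bsub>?M\<^esub> C \<otimes>\<^bsub>?M\<^esub> B"
    proof (intro eq_matI)
      fix i j assume "i < dim_row (C \<otimes>\<^bsub>?M\<^esub> A \<oplus>\<^bsub>?M\<^esub> C \<otimes>\<^bsub>?M\<^esub> B)"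
        "j < dim_col (C \<otimes>\<^bsub>?M\<^esub> A \<oplus>\<^bsub>?M\<^esub> C \<otimes>\<^bsub>?M\<^esub> B)"
      then have ij: "i < k" "j < k" by (auto simp: matrix_ring_def)
      have "(\<Oplus>l\<in>{..<k}. C $$ (i, l) \<otimes> (A \<oplus>\<^bsub>?M\<^esub> B) $$ (l, j))
          = (\<Oplus>l\<in>{..<k}. C $$ (i, l) \<otimes> A $$ (l, j) \<oplus> C $$ (i, l) \<otimes> B $$ (l, j))"
        using A B C ij by (intro finsum_cong') (auto simp: iff add_index r_distr)
      also have "\<dots> = (\<Oplus>l\<in>{..<k}. C $$ (i, l) \<otimes> A $$ (l, j))
          \<oplus> (\<Oplus>l\<in>{..<k}. C $$ (i, l) \<otimes> B $$ (l, j))"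
        using A B C ij by (intro finsum_addf) (auto simp: iff)
      finally show "(C \<otimes>\<^bsub>?M\<^esub> (A \<oplus>\<^bsub>?M\<^esub> B)) $$ (i, j)
          = (C \<otimes>\<^bsub>?M\<^esub> A \<oplus>\<^bsub>?M\<^esub> C \<otimes>\<^bsub>?M\<^esub> B) $$ (i, j)"
        using ij by (simp add: add_index mult_index)
    qed (auto simp: matrix_ring_def)
    show "A \<otimes>\<^bsub>?M\<^esub> B \<otimes>\<^bsub>?M\<^esub> C = A \<otimes>\<^bsub>?M\<^esub> (B \<otimes>\<^bsub>?M\<^esub> C)"
    proof (intro eq_matI)
      fix i j assume "i < dim_row (A \<otimes>\<^bsub>?M\<^esub> (B \<otimes>\<^bsub>?M\<^esub> C))" "j < dim_col (A \<otimes>\<^bsub>?M\<^esub> (B \<otimes>\<^bsub>?M\<^esub> C))"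
      then have ij: "i < k" "j < k" by (auto simp: matrix_ring_def)
      let ?t = "\<lambda>h l. A $$ (i, h) \<otimes> B $$ (h, l) \<otimes> C $$ (l, j)"
      have "(\<Oplus>l\<in>{..<k}. (A \<otimes>\<^bsub>?M\<^esub> B) $$ (i, l) \<otimes> C $$ (l, j))
          = (\<Oplus>l\<in>{..<k}. \<Oplus>h\<in>{..<k}. ?t h l)"
        using A B C ij by (intro finsum_cong')
          (auto simp: iff mult_index finsum_ldistr Pi_def)
      also have "\<dots> = (\<Oplus>h\<in>{..<k}. \<Oplus>l\<in>{..<k}. ?t h l)"
        using A B C ij by (intro finsum_swap) (auto simp: iff)
      also have "\<dots> = (\<Oplus>h\<in>{..<k}. A $$ (i, h) \<otimes> (B \<otimes>\<^bsub>?M\<^esub> C) $$ (h, j))"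
      proof (intro finsum_cong')
        fix h assume "h \<in> {..<k}"
        then have h: "h < k" by simp
        have "(\<Oplus>l\<in>{..<k}. ?t h l) = (\<Oplus>l\<in>{..<k}. A $$ (i, h) \<otimes> (B $$ (h, l) \<otimes> C $$ (l, j)))"
          using A B C ij h by (intro finsum_cong') (auto simp: iff m_assoc)
        then show "(\<Oplus>l\<in>{..<k}. ?t h l) = A $$ (i, h) \<otimes> (B \<otimes>\<^bsub>?M\<^esub> C) $$ (h, j)"
          using A B C ij h by (simp add: iff mult_index finsum_rdistr Pi_def)
      qed (use A B C ij in \<open>auto simp: iff mult_index Pi_def intro!: finsum_closed\<close>)
      finally show "(A \<otimes>\<^bsub>?M\<^esub> B \<otimes>\<^bsub>?M\<^esub> C) $$ (i, j) = (A \<otimes>\<^bsub>?M\<^esub> (B \<otimes>\<^bsub>?M\<^esub> C)) $$ (i, j)"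
        using ij by (simp add: add_index mult_index)
    qed (auto simp: matrix_ring_def)
  }
qed (auto simp: matrix_ring_carrier_iff matrix_ring_def)

end

theory Submission
  imports Defs "HOL-Algebra.Ring_Divisibility"
begin

text \<open>
  The matrix ring turns out to be strongly \<open>\<pi>\<close>-regular: every power sequence \<open>A, A\<^sup>2, \<dots>\<close> stabilises up
  to right and left multiples, so some power of \<open>A\<close> has a group inverse, and the idempotent it
  generates commutes with \<open>A\<close> and serves as witness for
  \<open>(p, q) \<noteq> (0, 0)\<close>, while for \<open>(0, 0)\<close> the witness is \<open>1\<close>. If \<open>A\<close> were a counterexample, Zorn's
  lemma would give an ideal \<open>P\<close> maximal among those modulo which \<open>A\<close> is still a counterexample.
  Such a \<open>P\<close> is prime, because the stabilisation property modulo \<open>J\<close> and modulo \<open>K\<close> implies it modulo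
  every ideal containing \<open>J \<cdot> K\<close>. But \<open>P\<close> contains the nilpotent elements, and in the reduced quotient
  by those every \<open>a\<close> equals \<open>a e\<close> for a central idempotent \<open>e \<in> a\<^sup>m R a\<^sup>n\<close>. Modulo \<open>P\<close> the idempotent is
  \<open>0\<close> or \<open>1\<close>, so \<open>R / P\<close> is a division ring. There the powers of a \<open>k \<times> k\<close> matrix are linearly
  dependent on either side, and solving a dependence for its lowest power stabilises the powers.
\<close>

subsection \<open>Opposite rings and prime ideals\<close>

text \<open>Mirror images of one-sided facts are obtained by instantiating them in this ring. Only
  multiplication is replaced in the record, so negatives, finite sums and two-sided ideals are
  unaffected.\<close>

definition opposite_ring :: "('a, 'b) ring_scheme \<Rightarrow> ('a, 'b) ring_scheme" where
  "opposite_ring R = R\<lparr>monoid.mult := \<lambda>x y. y \<otimes>\<^bsub>R\<^esub> x\<rparr>"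

lemma opposite_ring_simps [simp]:
  "carrier (opposite_ring R) = carrier R"
  "x \<otimes>\<^bsub>opposite_ring R\<^esub> y = y \<otimes>\<^bsub>R\<^esub> x"
  "x \<oplus>\<^bsub>opposite_ring R\<^esub> y = x \<oplus>\<^bsub>R\<^esub> y"
  "\<zero>\<^bsub>opposite_ring R\<^esub> = \<zero>\<^bsub>R\<^esub>"
  "\<one>\<^bsub>opposite_ring R\<^esub> = \<one>\<^bsub>R\<^esub>"
  by (simp_all add: opposite_ring_def)

lemma a_minus_opposite_ring [simp]: "x \<ominus>\<^bsub>opposite_ring R\<^esub> y = x \<ominus>\<^bsub>R\<^esub> y"
  by (simp add: opposite_ring_def a_minus_def a_inv_def m_inv_def)

lemma finsum_opposite_ring [simp]: "finsum (opposite_ring R) f S = finsum R f S"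
  by (simp add: opposite_ring_def finsum_def)

context ring
begin

lemma opposite_ring_is_ring: "ring (opposite_ring R)"
proof (intro ringI abelian_groupI monoidI)
  show "\<exists>y\<in>carrier (opposite_ring R). y \<oplus>\<^bsub>opposite_ring R\<^esub> x = \<zero>\<^bsub>opposite_ring R\<^esub>"
    if "x \<in> carrier (opposite_ring R)" for x
    using that by (auto intro!: bexI[of _ "\<ominus> x"] l_neg)
qed (auto simp: m_assoc a_ac l_distr r_distr)

lemma nat_pow_opposite_ring [simp]:
  assumes "x \<in> carrier R"
  shows "x [^]\<^bsub>opposite_ring R\<^esub> (n::nat) = x [^] n"
  using assms by (induction n) (simp_all flip: nat_pow_Suc2)

lemma ideal_opposite_ring:
  assumes "ideal I R"
  shows "ideal I (opposite_ring R)"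
proof (rule idealI)
  interpret I: ideal I R by fact
  show "subgroup I (add_monoid (opposite_ring R))"
    using I.a_subgroup by (simp add: opposite_ring_def)
qed (use assms opposite_ring_is_ring in \<open>auto intro: ideal.I_l_closed ideal.I_r_closed\<close>)

section \<open>Cosets, sums in ideals and prime ideals\<close>

lemma a_rcos_eq_zero_iff:
  assumes "ideal I R" "x \<in> carrier R"
  shows "I +> x = \<zero>\<^bsub>R Quot I\<^esub> \<longleftrightarrow> x \<in> I"
  using assms a_rcos_zero ideal.rcos_const_imp_mem by (fastforce simp: FactRing_def)

lemma finsum_in_ideal:
  assumes "ideal I R" "finite S" "\<And>i. i \<in> S \<Longrightarrow> f i \<in> I"
  shows "(\<Oplus>i\<in>S. f i) \<in> I"
proof -
  interpret I: ideal I R by fact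
  show ?thesis
    using assms(2,3) by (induction S rule: finite_induct) (auto simp: Pi_def)
qed

text \<open>Instead of the ideals generated by \<open>a\<close> and \<open>b\<close>, take
  \<open>I\<close>, the elements x with x R b inside \<open>P\<close>, and \<open>J\<close>, the
  elements that \<open>I\<close> multiplies into \<open>P\<close>. Both are two-sided, their product
  lies in \<open>P\<close>, and they contain \<open>a\<close> and \<open>b\<close>
  respectively.\<close>

lemma nc_prime_ideal_mult_closed:
  assumes P: "nc_prime_ideal P R" and ab: "a \<in> carrier R" "b \<in> carrier R"
    and prod: "\<And>r. r \<in> carrier R \<Longrightarrow> a \<otimes> r \<otimes> b \<in> P"
  shows "a \<in> P \<or> b \<in> P"
proof -
  interpret P: ideal P R using P by (simp add: nc_prime_ideal_def)
  define I where "I = {x \<in> carrier R. \<forall>r\<in>carrier R. x \<otimes> r \<otimes> b \<in> P}"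
  define J where "J = {y \<in> carrier R. \<forall>x\<in>I. x \<otimes> y \<in> P}"
  have I: "ideal I R"
  proof (rule idealI)
    show "subgroup I (add_monoid R)"
    proof (rule add.subgroupI)
      show "\<ominus> x \<in> I" if "x \<in> I" for x
        using that ab by (auto simp: I_def l_minus)
    qed (use ab in \<open>auto simp: I_def l_distr intro!: exI[of _ \<zero>]\<close>)
    fix x s assume x: "x \<in> I" and s: "s \<in> carrier R"
    then have "s \<otimes> x \<otimes> r \<otimes> b = s \<otimes> (x \<otimes> r \<otimes> b)" if "r \<in> carrier R" for r
      using that ab by (simp add: I_def m_assoc)
    then show "s \<otimes> x \<in> I" using x s by (auto simp: I_def intro: P.I_l_closed)
    have "x \<otimes> s \<otimes> r \<otimes> b = x \<otimes> (s \<otimes> r) \<otimes> b" if "r \<in> carrier R" for r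
      using that ab x s by (simp add: I_def m_assoc)
    then show "x \<otimes> s \<in> I" using x s by (auto simp: I_def)
  qed (rule ring_axioms)
  have Icarr: "x \<in> carrier R" if "x \<in> I" for x using that by (simp add: I_def)
  have J: "ideal J R"
  proof (rule idealI)
    show "subgroup J (add_monoid R)"
    proof (rule add.subgroupI)
      show "\<ominus> x \<in> J" if "x \<in> J" for x
        using that Icarr by (auto simp: J_def r_minus)
    qed (use Icarr in \<open>auto simp: J_def r_distr intro!: exI[of _ \<zero>]\<close>)
    fix y s assume y: "y \<in> J" and s: "s \<in> carrier R"
    have "x \<otimes> (s \<otimes> y) = x \<otimes> s \<otimes> y" "x \<otimes> s \<in> I" if "x \<in> I" for x
      using that y s Icarr ideal.I_r_closed[OF I] by (auto simp: J_def m_assoc)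
    then show "s \<otimes> y \<in> J" using y s by (auto simp: J_def)
    have "x \<otimes> (y \<otimes> s) = x \<otimes> y \<otimes> s" if "x \<in> I" for x
      using that y s Icarr by (auto simp: J_def m_assoc)
    then show "y \<otimes> s \<in> J" using y s by (auto simp: J_def intro: P.I_r_closed)
  qed (rule ring_axioms)
  have "I \<cdot> J \<subseteq> P"
  proof
    fix x assume "x \<in> I \<cdot> J"
    then show "x \<in> P" by induction (auto simp: J_def)
  qed
  then have "I \<subseteq> P \<or> J \<subseteq> P"
    using P I J by (simp add: nc_prime_ideal_def)
  moreover have "a \<in> I" using ab prod by (simp add: I_def)
  moreover have "x \<otimes> b \<in> P" if "x \<in> I" for x
  proof -
    have "x \<otimes> \<one> \<otimes> b \<in> P" using that unfolding I_def by blast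
    then show ?thesis using that Icarr by simp
  qed
  then have "b \<in> J" using ab by (simp add: J_def)
  ultimately show ?thesis by blast
qed

text \<open>Zorn's lemma abstracted over \<open>Q\<close>: by \<open>chain\<close>, failure of
  \<open>Q\<close> passes to unions of chains, so some ideal \<open>P\<close> is maximal among those
  failing \<open>Q\<close>. For an ideal \<open>I\<close> outside \<open>P\<close> the sum
  \<open>P + I\<close> is strictly larger, so \<open>Q\<close> holds there. If \<open>I\<close> and
  \<open>J\<close> were both outside but their product inside \<open>P\<close>, then
  \<open>prod\<close> for the two sums would yield \<open>Q P\<close>. \<open>Q (carrier R)\<close>
  makes \<open>P\<close> proper.\<close>

lemma obtain_nc_prime_ideal:
  assumes "\<not> Q {\<zero>}" and "Q (carrier R)"
    and chain: "\<And>C. C \<noteq> {} \<Longrightarrow> subset.chain {I. ideal I R} C \<Longrightarrow> Q (\<Union>C) \<Longrightarrow> \<exists>I\<in>C. Q I"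
    and prod: "\<And>I J K. ideal I R \<Longrightarrow> ideal J R \<Longrightarrow> ideal K R \<Longrightarrow> Q J \<Longrightarrow> Q K
      \<Longrightarrow> (\<And>x y. x \<in> J \<Longrightarrow> y \<in> K \<Longrightarrow> x \<otimes> y \<in> I) \<Longrightarrow> Q I"
  obtains P where "nc_prime_ideal P R" "\<not> Q P"
proof -
  let ?F = "{I. ideal I R \<and> \<not> Q I}"
  have "\<exists>P\<in>?F. \<forall>X\<in>?F. P \<subseteq> X \<longrightarrow> X = P"
  proof (rule subset_Zorn_nonempty)
    show "?F \<noteq> {}" using assms(1) zeroideal by blast
    fix C assume C: "C \<noteq> {}" "subset.chain ?F C"
    then have C': "subset.chain {I. ideal I R} C"
      by (auto simp: subset.chain_def)
    then have "ideal (\<Union>C) R" using chain_Union_is_ideal[OF C'] C(1) by simp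
    then show "\<Union>C \<in> ?F" using C chain[OF C(1) C'] by (auto simp: subset.chain_def)
  qed
  then obtain P where P: "ideal P R" "\<not> Q P"
    and max: "\<And>X. ideal X R \<Longrightarrow> P \<subseteq> X \<Longrightarrow> X \<noteq> P \<Longrightarrow> Q X" by blast
  interpret P: ideal P R by fact
  have sum_good: "Q (P <+>\<^bsub>R\<^esub> I)" if I: "ideal I R" "\<not> I \<subseteq> P" for I
  proof (rule max)
    interpret I: ideal I R by fact
    show "ideal (P <+>\<^bsub>R\<^esub> I) R" by (intro add_ideals P I)
    show "P \<subseteq> P <+>\<^bsub>R\<^esub> I"
    proof
      fix x assume x: "x \<in> P"
      then have "x \<oplus> \<zero> \<in> P <+>\<^bsub>R\<^esub> I" using I.zero_closed unfolding set_add_def' by blast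
      then show "x \<in> P <+>\<^bsub>R\<^esub> I" using x P.Icarr by simp
    qed
    have "I \<subseteq> P <+>\<^bsub>R\<^esub> I"
    proof
      fix x assume x: "x \<in> I"
      then have "\<zero> \<oplus> x \<in> P <+>\<^bsub>R\<^esub> I" using P.zero_closed unfolding set_add_def' by blast
      then show "x \<in> P <+>\<^bsub>R\<^esub> I" using x I.Icarr by simp
    qed
    then show "P <+>\<^bsub>R\<^esub> I \<noteq> P" using I(2) by auto
  qed
  have "I \<subseteq> P \<or> J \<subseteq> P" if IJ: "ideal I R" "ideal J R" "I \<cdot> J \<subseteq> P" for I J
  proof (rule ccontr)
    assume "\<not> (I \<subseteq> P \<or> J \<subseteq> P)"
    then have "Q (P <+>\<^bsub>R\<^esub> I)" "Q (P <+>\<^bsub>R\<^esub> J)" using sum_good IJ by auto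
    \<comment> \<open>Expanding the product of \<open>u + i\<close> and \<open>v + j\<close>, every
      term except \<open>i j\<close> has a factor in \<open>P\<close>, and \<open>i j\<close> lies
      in the product of the two ideals.\<close>
    moreover have "x \<otimes> y \<in> P" if xy: "x \<in> P <+>\<^bsub>R\<^esub> I" "y \<in> P <+>\<^bsub>R\<^esub> J" for x y
    proof -
      obtain u i where u: "u \<in> P" "i \<in> I" "x = u \<oplus> i" using xy by (auto simp: set_add_def')
      obtain v j where v: "v \<in> P" "j \<in> J" "y = v \<oplus> j" using xy by (auto simp: set_add_def')
      have c: "i \<in> carrier R" "j \<in> carrier R" "u \<in> carrier R" "v \<in> carrier R"
        using u v ideal.Icarr[OF IJ(1)] ideal.Icarr[OF IJ(2)] P.Icarr by auto
      have "i \<otimes> j \<in> P" using u v IJ(3) ideal_prod.prod[of i I j J R] by blast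
      moreover have "u \<otimes> y \<in> P" using u(1) v(3) c by (simp add: P.I_r_closed)
      moreover have "i \<otimes> v \<in> P" using v(1) c by (simp add: P.I_l_closed)
      ultimately have "u \<otimes> y \<oplus> (i \<otimes> v \<oplus> i \<otimes> j) \<in> P" by (intro P.a_closed)
      moreover have "x \<otimes> y = u \<otimes> y \<oplus> (i \<otimes> v \<oplus> i \<otimes> j)"
        using c by (simp add: u(3) v(3) l_distr r_distr a_ac)
      ultimately show ?thesis by simp
    qed
    ultimately have "Q P" using prod[OF P(1) add_ideals[OF P(1) IJ(1)] add_ideals[OF P(1) IJ(2)]] by blast
    then show False using P by simp
  qed
  then have "nc_prime_ideal P R"
    using P assms(2) by (auto simp: nc_prime_ideal_def)
  then show ?thesis using P that by blast
qed


subsection \<open>Two-primal regularly nil clean rings modulo a prime ideal\<close>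

text \<open>With \<open>f = 1 - e\<close>, the elements \<open>e x f\<close> and
  \<open>f x e\<close> square to zero because \<open>e f = f e = 0\<close>. They therefore vanish,
  so both products equal \<open>e x e\<close>.\<close>

lemma reduced_imp_idempotent_central:
  assumes red: "nilpotents R \<subseteq> {\<zero>}" and e: "e \<in> idempotents R" and x: "x \<in> carrier R"
  shows "e \<otimes> x = x \<otimes> e"
proof -
  have red': "y = \<zero>" if "y \<in> carrier R" "y \<otimes> y = \<zero>" for y
  proof -
    have "y [^] (2::nat) = \<zero>" using that by (simp add: numeral_2_eq_2)
    then show ?thesis using that red by (auto simp: nilpotents_def)
  qed
  have ec: "e \<in> carrier R" and ee: "e \<otimes> e = e" using e by (auto simp: idempotents_def)
  define f where "f = \<one> \<ominus> e"
  have fc: "f \<in> carrier R" using ec by (simp add: f_def)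
  have ef: "e \<otimes> f = \<zero>" and fe: "f \<otimes> e = \<zero>"
    using ec ee by (simp_all add: f_def a_minus_def l_distr r_distr l_minus r_minus r_neg)
  have "(e \<otimes> x \<otimes> f) \<otimes> (e \<otimes> x \<otimes> f) = e \<otimes> x \<otimes> (f \<otimes> e) \<otimes> (x \<otimes> f)"
    "(f \<otimes> x \<otimes> e) \<otimes> (f \<otimes> x \<otimes> e) = f \<otimes> x \<otimes> (e \<otimes> f) \<otimes> (x \<otimes> e)"
    using ec fc x by (simp_all add: m_assoc)
  then have "e \<otimes> x \<otimes> f = \<zero>" "f \<otimes> x \<otimes> e = \<zero>"
    using ec fc x by (auto intro!: red' simp: ef fe)
  moreover have "e \<otimes> x \<otimes> f = e \<otimes> x \<ominus> e \<otimes> x \<otimes> e" "f \<otimes> x \<otimes> e = x \<otimes> e \<ominus> e \<otimes> x \<otimes> e"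
    using ec x by (simp_all add: f_def a_minus_def l_distr r_distr l_minus r_minus)
  ultimately have "e \<otimes> x = e \<otimes> x \<otimes> e" "x \<otimes> e = e \<otimes> x \<otimes> e" using ec x by auto
  then show ?thesis by simp
qed

lemma one_minus_idempotent:
  assumes "e \<in> idempotents R"
  shows "\<one> \<ominus> e \<in> idempotents R"
  using assms by (simp add: idempotents_def a_minus_def l_distr r_distr l_minus r_minus r_neg)

lemma reduced_imp_absorbs_idempotent:
  assumes red: "nilpotents R \<subseteq> {\<zero>}" and e: "e \<in> idempotents R" and a: "a \<in> carrier R"
    and zero: "a [^] m \<otimes> (\<one> \<ominus> e) \<otimes> a [^] n = \<zero>" and mn: "(m, n) \<noteq> (0 :: nat, 0 :: nat)"
  shows "a \<otimes> e = a"
proof -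
  define f where "f = \<one> \<ominus> e"
  have f: "f \<in> idempotents R" using one_minus_idempotent[OF e] by (simp add: f_def)
  then have fc: "f \<in> carrier R" by (simp add: idempotents_def)
  have comm: "f \<otimes> x = x \<otimes> f" if "x \<in> carrier R" for x
    using reduced_imp_idempotent_central[OF red f that] .
  obtain j where j: "m + n = Suc j" using mn by (cases "m + n") auto
  have "a [^] (m + n) \<otimes> f = a [^] m \<otimes> f \<otimes> a [^] n"
    using a fc comm by (simp add: m_assoc flip: nat_pow_mult)
  then have *: "a [^] (m + n) \<otimes> f = \<zero>" using zero by (simp add: f_def)
  \<comment> \<open>Centrality of \<open>f\<close> splits the power. Since \<open>m + n\<close> is
    positive, one factor \<open>f\<close> can be moved next to \<open>a^(m + n)\<close>, where it
    gives zero; reducedness then kills \<open>a f\<close>.\<close>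
  have "(a \<otimes> f) [^] (m + n) = a [^] (m + n) \<otimes> f [^] Suc j"
    using a fc comm j by (subst pow_mult_distrib) auto
  also have "\<dots> = a [^] (m + n) \<otimes> f \<otimes> f [^] j"
    using a fc by (simp only: nat_pow_Suc2 m_assoc nat_pow_closed)
  finally have "(a \<otimes> f) [^] (m + n) = \<zero>" using * fc by simp
  then have "a \<otimes> f = \<zero>" using red a fc by (auto simp: nilpotents_def)
  moreover have "a \<otimes> f = a \<ominus> a \<otimes> e"
    using a e by (simp add: f_def idempotents_def a_minus_def r_distr r_minus)
  ultimately show ?thesis using a e by (simp add: idempotents_def)
qed

section \<open>The prime radical and the quotient by the nilpotent elements\<close>

lemma ideal_prime_radical: "ideal (prime_radical R) R"
proof -
  \<comment> \<open>Adjoining the whole ring accounts for the intersection with the carrier and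
    keeps the family nonempty even when there is no prime ideal.\<close>
  have "prime_radical R = \<Inter>(insert (carrier R) {P. nc_prime_ideal P R})"
    by (auto simp: prime_radical_def)
  then show ?thesis
    using i_Intersect[of "insert (carrier R) {P. nc_prime_ideal P R}"] oneideal
    by (auto simp: nc_prime_ideal_def)
qed

lemma nilpotents_factor_nilpotents:
  assumes N: "ideal (nilpotents R) R"
  shows "nilpotents (R Quot nilpotents R) \<subseteq> {\<zero>\<^bsub>R Quot nilpotents R\<^esub>}"
proof
  fix y assume "y \<in> nilpotents (R Quot nilpotents R)"
  then obtain n :: nat where y: "y \<in> carrier (R Quot nilpotents R)"
    and n: "y [^]\<^bsub>R Quot nilpotents R\<^esub> n = \<zero>\<^bsub>R Quot nilpotents R\<^esub>"
    unfolding nilpotents_def[of "R Quot nilpotents R"] by blast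
  from y obtain x where x: "x \<in> carrier R" "y = nilpotents R +> x"
    by (auto simp: FactRing_def A_RCOSETS_def')
  interpret h: ring_hom_ring R "R Quot nilpotents R" "(+>) (nilpotents R)"
    by (rule ideal.rcos_ring_hom_ring[OF N])
  have "nilpotents R +> x [^] n = \<zero>\<^bsub>R Quot nilpotents R\<^esub>"
    using n x h.hom_nat_pow by simp
  then have "x [^] n \<in> nilpotents R" using a_rcos_eq_zero_iff[OF N] x by blast
  then obtain j :: nat where "(x [^] n) [^] j = \<zero>" by (auto simp: nilpotents_def)
  then have "x \<in> nilpotents R" using x by (auto simp: nilpotents_def nat_pow_pow)
  then show "y \<in> {\<zero>\<^bsub>R Quot nilpotents R\<^esub>}" using a_rcos_eq_zero_iff[OF N] x by blast
qed

section \<open>Inverses modulo a prime ideal\<close>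

text \<open>The group-theoretic argument on representatives: a left inverse \<open>b\<close> of
  \<open>a\<close> has itself a left inverse \<open>c\<close>, and \<open>c\<close> is forced to
  agree with \<open>a\<close> modulo \<open>P\<close>.\<close>

lemma left_inverses_imp_right_inverse_mod:
  assumes P: "ideal P R" and one: "\<one> \<notin> P"
    and left: "\<And>a. a \<in> carrier R - P \<Longrightarrow> \<exists>b\<in>carrier R. \<one> \<ominus> b \<otimes> a \<in> P"
    and a: "a \<in> carrier R - P"
  shows "\<exists>b\<in>carrier R. \<one> \<ominus> a \<otimes> b \<in> P \<and> \<one> \<ominus> b \<otimes> a \<in> P"
proof -
  interpret P: ideal P R by fact
  obtain b where b: "b \<in> carrier R" "\<one> \<ominus> b \<otimes> a \<in> P" using left a by blast
  have "b \<notin> P"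
  proof
    assume "b \<in> P"
    then have "(\<one> \<ominus> b \<otimes> a) \<oplus> b \<otimes> a \<in> P"
      using a b by (auto intro: P.a_closed P.I_r_closed)
    then show False using a b one by (simp add: a_minus_def a_assoc l_neg)
  qed
  then obtain c where c: "c \<in> carrier R" "\<one> \<ominus> c \<otimes> b \<in> P" using left b by blast
  \<comment> \<open>Each summand has a factor known to be in \<open>P\<close>, and expanding the sum
    leaves exactly \<open>1 - a b\<close>.\<close>
  have "(\<one> \<ominus> c \<otimes> b) \<otimes> (\<one> \<ominus> a \<otimes> b) \<oplus> c \<otimes> (\<one> \<ominus> b \<otimes> a) \<otimes> b \<in> P"
    using P.I_r_closed[OF c(2)] P.I_r_closed[OF P.I_l_closed[OF b(2) c(1)] b(1)] a b
    by (auto intro: P.a_closed)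
  also have "(\<one> \<ominus> c \<otimes> b) \<otimes> (\<one> \<ominus> a \<otimes> b) \<oplus> c \<otimes> (\<one> \<ominus> b \<otimes> a) \<otimes> b = \<one> \<ominus> a \<otimes> b"
    using a b c by (simp add: ring_simprules m_assoc r_neg1 r_neg2)
  finally show ?thesis using b by blast
qed

text \<open>\<open>P\<close> contains the nilpotents, so facts about the reduced quotient by them
  hold modulo \<open>P\<close>. They force the idempotent chosen for \<open>x\<close> outside
  \<open>P\<close> to be 1 modulo \<open>P\<close>; being of the form \<open>x^m r x^n\<close>, it
  then exhibits a one-sided inverse of \<open>x\<close>.\<close>

lemma two_primal_regularly_nil_clean_inverse_mod:
  assumes tp: "two_primal R" and rnc: "regularly_nil_clean m n R" and mn: "(m, n) \<noteq> (0, 0)"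
    and P: "nc_prime_ideal P R" and a: "a \<in> carrier R - P"
  shows "\<exists>b\<in>carrier R. \<one> \<ominus> a \<otimes> b \<in> P \<and> \<one> \<ominus> b \<otimes> a \<in> P"
proof -
  interpret P: ideal P R using P by (simp add: nc_prime_ideal_def)
  let ?N = "nilpotents R"
  let ?Q = "R Quot ?N"
  have N: "ideal ?N R" using tp ideal_prime_radical by (simp add: two_primal_def)
  interpret N: ideal ?N R by fact
  have NP: "?N \<subseteq> P" using tp P by (auto simp: two_primal_def prime_radical_def)
  interpret h: ring_hom_ring R ?Q "(+>) ?N" by (rule ideal.rcos_ring_hom_ring[OF N])
  note red = nilpotents_factor_nilpotents[OF N]
  have one: "\<one> \<notin> P" using P P.one_imp_carrier by (auto simp: nc_prime_ideal_def)
  have minus_in_N: "x \<ominus> y \<in> ?N" if "x \<in> carrier R" "y \<in> carrier R" "?N +> x = ?N +> y" for x y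
    using that a_rcos_eq_zero_iff[OF N] h.S.r_neg
    by (metis a_minus_def add.inv_closed h.hom_add h.hom_a_inv h.hom_closed minus_closed)
  have key: "\<exists>r\<in>carrier R. \<one> \<ominus> x [^] m \<otimes> r \<otimes> x [^] n \<in> P" if x: "x \<in> carrier R - P" for x
  proof -
    obtain e r where e: "e \<in> idempotents R" and r: "r \<in> carrier R" "e = x [^] m \<otimes> r \<otimes> x [^] n"
      and nil: "x [^] m \<otimes> (\<one> \<ominus> e) \<otimes> x [^] n \<in> ?N"
      using rnc x unfolding regularly_nil_clean_def by blast
    have ec: "e \<in> carrier R" and ee: "e \<otimes> e = e" using e by (auto simp: idempotents_def)
    have e': "?N +> e \<in> idempotents ?Q"
      using ec ee by (simp add: idempotents_def flip: h.hom_mult)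
    have "(?N +> x) [^]\<^bsub>?Q\<^esub> m \<otimes>\<^bsub>?Q\<^esub> (\<one>\<^bsub>?Q\<^esub> \<ominus>\<^bsub>?Q\<^esub> (?N +> e)) \<otimes>\<^bsub>?Q\<^esub> (?N +> x) [^]\<^bsub>?Q\<^esub> n
        = ?N +> (x [^] m \<otimes> (\<one> \<ominus> e) \<otimes> x [^] n)"
      using x ec by (simp add: a_minus_def h.hom_nat_pow)
    also have "\<dots> = \<zero>\<^bsub>?Q\<^esub>" using nil a_rcos_eq_zero_iff[OF N] N.Icarr by blast
    finally have "(?N +> x) \<otimes>\<^bsub>?Q\<^esub> (?N +> e) = ?N +> x"
      using x mn by (intro h.S.reduced_imp_absorbs_idempotent[OF red e']) auto
    then have "x \<ominus> x \<otimes> e \<in> ?N" using x ec by (intro minus_in_N) auto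
    then have xe: "x \<ominus> x \<otimes> e \<in> P" using NP by blast
    \<comment> \<open>Primeness is to be applied to \<open>e\<close> and \<open>1 - e\<close>. The
      commutator of \<open>e\<close> and \<open>y\<close> is nilpotent because \<open>e\<close> is
      central in the quotient; multiplying it by \<open>1 - e\<close> removes its second
      term.\<close>
    have "e \<otimes> y \<otimes> (\<one> \<ominus> e) \<in> P" if y: "y \<in> carrier R" for y
    proof -
      have "(?N +> e) \<otimes>\<^bsub>?Q\<^esub> (?N +> y) = (?N +> y) \<otimes>\<^bsub>?Q\<^esub> (?N +> e)"
        using y by (intro h.S.reduced_imp_idempotent_central[OF red e']) auto
      then have "e \<otimes> y \<ominus> y \<otimes> e \<in> ?N" using y ec by (intro minus_in_N) auto
      then have "(e \<otimes> y \<ominus> y \<otimes> e) \<otimes> (\<one> \<ominus> e) \<in> P" using NP ec by (auto intro: P.I_r_closed)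
      also have "(e \<otimes> y \<ominus> y \<otimes> e) \<otimes> (\<one> \<ominus> e)
          = e \<otimes> y \<otimes> (\<one> \<ominus> e) \<ominus> y \<otimes> (e \<otimes> (\<one> \<ominus> e))"
        using y ec by (simp add: a_minus_def[of R "e \<otimes> y"] a_minus_def[of R "e \<otimes> y \<otimes> _"]
            a_minus_def[of R "e \<otimes> (y \<otimes> _)"] l_distr l_minus m_assoc)
      also have "e \<otimes> (\<one> \<ominus> e) = \<zero>"
        using ec ee by (simp add: a_minus_def r_distr r_minus r_neg)
      also have "e \<otimes> y \<otimes> (\<one> \<ominus> e) \<ominus> y \<otimes> \<zero> = e \<otimes> y \<otimes> (\<one> \<ominus> e)"
        using y ec by (simp add: a_minus_def)
      finally show ?thesis .
    qed
    then have "e \<in> P \<or> \<one> \<ominus> e \<in> P" using nc_prime_ideal_mult_closed[OF P ec] ec by simp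
    moreover have "e \<notin> P"
    proof
      assume "e \<in> P"
      then have "(x \<ominus> x \<otimes> e) \<oplus> x \<otimes> e \<in> P" using x xe by (auto intro: P.I_l_closed P.a_closed)
      then show False using x ec by (simp add: a_minus_def a_assoc l_neg)
    qed
    ultimately show ?thesis using r by blast
  qed
  \<comment> \<open>If \<open>n > 0\<close>, then \<open>x^n\<close> ends in \<open>x\<close> and a
    left inverse appears. If \<open>n = 0\<close>, then \<open>x^m\<close> begins with
    \<open>x\<close> and gives a right inverse, and the upgrade to two sides is done in the opposite
    ring.\<close>
  show ?thesis
  proof (cases n)
    case (Suc n')
    have "\<exists>b\<in>carrier R. \<one> \<ominus> b \<otimes> x \<in> P" if x: "x \<in> carrier R - P" for x
    proof -
      obtain r where "r \<in> carrier R" "\<one> \<ominus> x [^] m \<otimes> r \<otimes> x [^] n \<in> P" using key[OF x] by blast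
      then show ?thesis
        using x Suc by (intro bexI[of _ "x [^] m \<otimes> r \<otimes> x [^] n'"]) (auto simp: m_assoc)
    qed
    then show ?thesis using left_inverses_imp_right_inverse_mod[OF P.is_ideal one _ a] by blast
  next
    case 0
    then obtain m' where m': "m = Suc m'" using mn by (cases m) auto
    have "\<exists>b\<in>carrier R. \<one> \<ominus> x \<otimes> b \<in> P" if x: "x \<in> carrier R - P" for x
    proof -
      obtain r where r: "r \<in> carrier R" "\<one> \<ominus> x [^] m \<otimes> r \<otimes> x [^] n \<in> P"
        using key[OF x] by blast
      have "x [^] m \<otimes> r \<otimes> x [^] n = x \<otimes> (x [^] m' \<otimes> r)"
        unfolding m' 0 using x r nat_pow_Suc2[of x m'] by (simp add: m_assoc del: nat_pow_Suc)
      then show ?thesis using x r by (intro bexI[of _ "x [^] m' \<otimes> r"]) auto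
    qed
    then show ?thesis
      using ring.left_inverses_imp_right_inverse_mod[OF opposite_ring_is_ring
          ideal_opposite_ring[OF P.is_ideal], of a] one a by auto
  qed
qed

text \<open>Gaussian elimination over the division ring \<open>R / P\<close>, carried out on representatives.\<close>
lemma linear_dependence_mod:
  assumes P: "ideal P R" and one: "\<one> \<notin> P"
    and inverse: "\<And>a. a \<in> carrier R - P \<Longrightarrow> \<exists>b\<in>carrier R. \<one> \<ominus> b \<otimes> a \<in> P"
    and "finite T" "finite S" "card T < card S"
    and "\<And>i t. i \<in> S \<Longrightarrow> t \<in> T \<Longrightarrow> v i t \<in> carrier R"
  shows "\<exists>c. (\<forall>i\<in>S. c i \<in> carrier R) \<and> (\<exists>i\<in>S. c i \<notin> P) \<and>
    (\<forall>t\<in>T. (\<Oplus>i\<in>S. c i \<otimes> v i t) \<in> P)"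
  using assms(4-)
proof (induction T arbitrary: S v rule: finite_induct)
  case empty
  \<comment> \<open>There are no conditions left and \<open>S\<close> is nonempty, so any
    coefficient outside \<open>P\<close> works.\<close>
  then show ?case using one by (intro exI[of _ "\<lambda>_. \<one>"]) (auto simp: card_gt_0_iff)
next
  case (insert t T)
  interpret P: ideal P R by fact
  show ?case
  proof (cases "\<forall>i\<in>S. v i t \<in> P")
    case True
    obtain c where c: "\<forall>i\<in>S. c i \<in> carrier R" "\<exists>i\<in>S. c i \<notin> P"
      "\<forall>u\<in>T. (\<Oplus>i\<in>S. c i \<otimes> v i u) \<in> P"
      using insert.IH[of S v] insert.prems insert.hyps by auto
    have "(\<Oplus>i\<in>S. c i \<otimes> v i t) \<in> P"
      using True c(1) insert.prems by (intro finsum_in_ideal[OF P]) (auto intro: P.I_l_closed)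
    then show ?thesis using c by (intro exI[of _ c]) auto
  next
    case False
    then obtain p where p: "p \<in> S" "v p t \<notin> P" by blast
    define S' where "S' = S - {p}"
    have S: "S = insert p S'" "p \<notin> S'" "finite S'" using p insert.prems by (auto simp: S'_def)
    have v: "v i u \<in> carrier R" if "i \<in> S" "u \<in> insert t T" for i u using that insert.prems by auto
    obtain b where b: "b \<in> carrier R" "\<one> \<ominus> b \<otimes> v p t \<in> P" using inverse p v by blast
    \<comment> \<open>Row \<open>i\<close> after clearing position \<open>t\<close> with the pivot
      row \<open>p\<close>. Coefficients act from the left, so the multiplier \<open>v i t b\<close>
      stands on the left and \<open>b\<close> is a left inverse of the pivot.\<close>
    define w where "w i u = v i u \<ominus> v i t \<otimes> b \<otimes> v p u" for i u
    have w: "w i u \<in> carrier R" if "i \<in> S" "u \<in> insert t T" for i u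
      using that v p b by (auto simp: w_def)
    obtain c where c: "\<forall>i\<in>S'. c i \<in> carrier R" "\<exists>i\<in>S'. c i \<notin> P"
      "\<forall>u\<in>T. (\<Oplus>i\<in>S'. c i \<otimes> w i u) \<in> P"
    proof -
      have "card T < card S'" using insert.prems insert.hyps p by (simp add: S'_def)
      then show ?thesis using insert.IH[of S' w] w that S by auto
    qed
    have wt: "w i t \<in> P" if "i \<in> S'" for i
    proof -
      have "v i t \<otimes> (\<one> \<ominus> b \<otimes> v p t) \<in> P" using that S v b by (auto intro: P.I_l_closed)
      also have "v i t \<otimes> (\<one> \<ominus> b \<otimes> v p t) = w i t"
        using that S v b p by (simp add: w_def a_minus_def r_distr r_minus m_assoc)
      finally show ?thesis .
    qed
    have cw: "(\<Oplus>i\<in>S'. c i \<otimes> w i u) \<in> P" if "u \<in> insert t T" for u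
    proof (cases "u = t")
      case True
      then show ?thesis
        using c(1) wt S by (auto intro!: finsum_in_ideal[OF P] P.I_l_closed)
    qed (use that c in blast)
    \<comment> \<open>The coefficient at \<open>p\<close> collects the multiples of the pivot row
      that were subtracted in the \<open>w i\<close>, so that the combination of the
      \<open>v i\<close> with \<open>d\<close> equals that of the \<open>w i\<close> with
      \<open>c\<close>.\<close>
    define d where "d = (\<lambda>i. if i = p then \<ominus> (\<Oplus>i\<in>S'. c i \<otimes> (v i t \<otimes> b)) else c i)"
    have dp: "d p \<in> carrier R" using c v b S by (auto simp: d_def intro!: finsum_closed)
    have "(\<Oplus>i\<in>S. d i \<otimes> v i u) = (\<Oplus>i\<in>S'. c i \<otimes> w i u)" if u: "u \<in> insert t T" for u
    proof -
      have "(\<Oplus>i\<in>S'. c i \<otimes> w i u) \<oplus> (\<Oplus>i\<in>S'. c i \<otimes> (v i t \<otimes> b)) \<otimes> v p u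
          = (\<Oplus>i\<in>S'. c i \<otimes> w i u) \<oplus> (\<Oplus>i\<in>S'. c i \<otimes> (v i t \<otimes> b) \<otimes> v p u)"
        using u c v w b S by (subst finsum_ldistr) (auto simp: Pi_def)
      also have "\<dots> = (\<Oplus>i\<in>S'. c i \<otimes> w i u \<oplus> c i \<otimes> (v i t \<otimes> b) \<otimes> v p u)"
        using u c v w b S by (subst finsum_addf) (auto simp: Pi_def)
      also have "\<dots> = (\<Oplus>i\<in>S'. d i \<otimes> v i u)"
        using u c v w b S
        by (intro finsum_cong') (auto simp: d_def w_def a_minus_def r_distr r_minus m_assoc a_assoc l_neg)
      finally have "(\<Oplus>i\<in>S'. d i \<otimes> v i u)
        = (\<Oplus>i\<in>S'. c i \<otimes> w i u) \<oplus> (\<Oplus>i\<in>S'. c i \<otimes> (v i t \<otimes> b)) \<otimes> v p u" ..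
      moreover have "(\<Oplus>i\<in>S. d i \<otimes> v i u) = d p \<otimes> v p u \<oplus> (\<Oplus>i\<in>S'. d i \<otimes> v i u)"
        using u c v S dp unfolding S(1) by (subst finsum_insert) (auto simp: Pi_def d_def)
      moreover have "(\<Oplus>i\<in>S'. c i \<otimes> (v i t \<otimes> b)) \<in> carrier R" "(\<Oplus>i\<in>S'. c i \<otimes> w i u) \<in> carrier R"
        "v p u \<in> carrier R"
        using u c v w b S by (auto intro!: finsum_closed)
      ultimately show ?thesis by (simp add: d_def l_minus a_ac r_neg r_neg1 r_neg2)
    qed
    moreover have "\<exists>i\<in>S. d i \<notin> P" using c(2) S by (auto simp: d_def)
    moreover have "\<forall>i\<in>S. d i \<in> carrier R" using c dp S by (auto simp: d_def)
    ultimately show ?thesis using cw by (intro exI[of _ d]) auto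
  qed
qed

end


subsection \<open>Stabilisation of powers modulo an ideal\<close>

text \<open>The mirror condition \<open>a\<^sup>t \<in> R a\<^sup>t\<^sup>+\<^sup>1 + I\<close> is \<open>pow_absorbing\<close> of the opposite ring.\<close>
definition pow_absorbing :: "('a, 'b) ring_scheme \<Rightarrow> 'a \<Rightarrow> 'a set \<Rightarrow> bool" where
  "pow_absorbing R a I \<longleftrightarrow>
     (\<exists>t::nat. \<exists>x\<in>carrier R. a [^]\<^bsub>R\<^esub> t \<ominus>\<^bsub>R\<^esub> a [^]\<^bsub>R\<^esub> Suc t \<otimes>\<^bsub>R\<^esub> x \<in> I)"

context ring
begin

text \<open>The exponent \<open>t\<close> stays fixed while the gap grows: multiply the given
  congruence by \<open>a^u\<close> on the left and by the previous cofactor \<open>y\<close> on the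
  right. Only powers of \<open>a\<close> are commuted; \<open>x\<close> and \<open>y\<close> need
  not commute with \<open>a\<close>.\<close>

lemma pow_absorbing_iterate:
  assumes I: "ideal I R" and a: "a \<in> carrier R" and x: "x \<in> carrier R"
    and mem: "a [^] t \<ominus> a [^] Suc t \<otimes> x \<in> I"
  shows "\<exists>y\<in>carrier R. a [^] t \<ominus> a [^] (t + u) \<otimes> y \<in> I"
proof (induction u)
  case 0
  interpret I: ideal I R by fact
  show ?case using a by (intro bexI[of _ \<one>]) (auto simp: a_minus_def r_neg)
next
  case (Suc u)
  interpret I: ideal I R by fact
  obtain y where y: "y \<in> carrier R" "a [^] t \<ominus> a [^] (t + u) \<otimes> y \<in> I" using Suc.IH by blast
  have "a [^] u \<otimes> (a [^] t \<ominus> a [^] Suc t \<otimes> x) \<otimes> y \<in> I"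
    using mem a y by (intro I.I_r_closed I.I_l_closed) auto
  also have "a [^] u \<otimes> (a [^] t \<ominus> a [^] Suc t \<otimes> x) \<otimes> y
      = (a [^] u \<otimes> a [^] t) \<otimes> y \<ominus> (a [^] u \<otimes> a [^] Suc t) \<otimes> (x \<otimes> y)"
    using a x y by (simp add: a_minus_def l_distr r_distr l_minus r_minus m_assoc del: nat_pow_Suc)
  also have "\<dots> = a [^] (t + u) \<otimes> y \<ominus> a [^] (t + Suc u) \<otimes> (x \<otimes> y)"
    using a by (simp only: nat_pow_mult) (simp add: add.commute)
  finally have "(a [^] t \<ominus> a [^] (t + u) \<otimes> y)
      \<oplus> (a [^] (t + u) \<otimes> y \<ominus> a [^] (t + Suc u) \<otimes> (x \<otimes> y)) \<in> I"
    using y by (intro I.a_closed)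
  also have "(a [^] t \<ominus> a [^] (t + u) \<otimes> y)
      \<oplus> (a [^] (t + u) \<otimes> y \<ominus> a [^] (t + Suc u) \<otimes> (x \<otimes> y))
      = a [^] t \<ominus> a [^] (t + Suc u) \<otimes> (x \<otimes> y)"
    using a x y by (simp add: a_minus_def a_assoc r_neg1 del: nat_pow_Suc add_Suc_right)
  finally show ?case using x y by blast
qed

text \<open>Multiply an error term in \<open>I\<close> by an error term \<open>w\<close> in
  \<open>J\<close>. In the expansion everything but \<open>a^(s + t)\<close> starts with
  \<open>a^(s + t + 1)\<close>, giving the cofactor \<open>y + x w\<close>.\<close>

lemma pow_absorbing_product:
  assumes I: "ideal I R" and J: "ideal J R" and a: "a \<in> carrier R"
    and "pow_absorbing R a I" and "pow_absorbing R a J"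
    and K: "\<And>x y. x \<in> I \<Longrightarrow> y \<in> J \<Longrightarrow> x \<otimes> y \<in> K"
  shows "pow_absorbing R a K"
proof -
  obtain t y where y: "y \<in> carrier R" "a [^] (t::nat) \<ominus> a [^] Suc t \<otimes> y \<in> J"
    using assms(5) by (auto simp: pow_absorbing_def)
  obtain s x0 where "x0 \<in> carrier R" "a [^] (s::nat) \<ominus> a [^] Suc s \<otimes> x0 \<in> I"
    using assms(4) by (auto simp: pow_absorbing_def)
  \<comment> \<open>The gap \<open>t + 1\<close> is chosen so that this term and the one coming from
    \<open>a^s w\<close> share the left factor \<open>a^(s + t + 1)\<close>.\<close>
  then obtain x where x: "x \<in> carrier R" "a [^] s \<ominus> a [^] (s + Suc t) \<otimes> x \<in> I"
    using pow_absorbing_iterate[OF I a] by blast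
  define w where "w = a [^] t \<ominus> a [^] Suc t \<otimes> y"
  have w: "w \<in> carrier R" using a y by (simp add: w_def)
  have "(a [^] s \<ominus> a [^] (s + Suc t) \<otimes> x) \<otimes> w \<in> K" using K x y by (simp add: w_def)
  also have "(a [^] s \<ominus> a [^] (s + Suc t) \<otimes> x) \<otimes> w
      = a [^] s \<otimes> w \<ominus> a [^] (s + Suc t) \<otimes> (x \<otimes> w)"
    using a x w by (simp add: a_minus_def l_distr l_minus m_assoc del: nat_pow_Suc add_Suc_right)
  also have "a [^] s \<otimes> w = a [^] s \<otimes> a [^] t \<ominus> (a [^] s \<otimes> a [^] Suc t) \<otimes> y"
    using a y by (simp add: w_def a_minus_def r_distr r_minus m_assoc del: nat_pow_Suc)
  also have "\<dots> = a [^] (s + t) \<ominus> a [^] (s + Suc t) \<otimes> y"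
    using a by (simp only: nat_pow_mult)
  also have "a [^] (s + t) \<ominus> a [^] (s + Suc t) \<otimes> y \<ominus> a [^] (s + Suc t) \<otimes> (x \<otimes> w)
      = a [^] (s + t) \<ominus> a [^] Suc (s + t) \<otimes> (y \<oplus> x \<otimes> w)"
    using a x y w by (simp add: a_minus_def r_distr minus_add a_assoc del: nat_pow_Suc)
  finally show ?thesis using x y w unfolding pow_absorbing_def by blast
qed

text \<open>A relation among powers of \<open>a\<close> is solved for its lowest essential term:
  terms below \<open>p\<close> vanish modulo \<open>I\<close>, those above \<open>p\<close> share
  the left factor \<open>a^(p + 1)\<close>, and \<open>d\<close> cancels the coefficient of
  \<open>a^p\<close>.\<close>

lemma pow_absorbing_if_dependent:
  assumes I: "ideal I R" and a: "a \<in> carrier R" and S: "finite S" "p \<in> (S :: nat set)"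
    and x: "\<And>i. i \<in> S \<Longrightarrow> x i \<in> carrier R"
    and dep: "(\<Oplus>i\<in>S. a [^] i \<otimes> x i) \<in> I"
    and low: "\<And>i. i \<in> S \<Longrightarrow> i < p \<Longrightarrow> x i \<in> I"
    and d: "d \<in> carrier R" "\<one> \<ominus> x p \<otimes> d \<in> I"
  shows "pow_absorbing R a I"
proof -
  interpret I: ideal I R by fact
  define L where "L = {i \<in> S. i < p}"
  define H where "H = {i \<in> S. p < i}"
  have S_eq: "S = insert p (L \<union> H)" using S by (auto simp: L_def H_def)
  have fin: "finite L" "finite H" "L \<inter> H = {}" "p \<notin> L \<union> H" using S by (auto simp: L_def H_def)
  \<comment> \<open>The terms above \<open>p\<close> with \<open>a^(p + 1)\<close> split off; the
    subtraction is not truncated since \<open>p < i\<close> on \<open>H\<close>.\<close>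
  define z where "z = (\<Oplus>i\<in>H. a [^] (i - Suc p) \<otimes> x i)"
  have z: "z \<in> carrier R" using a x by (auto simp: z_def H_def intro!: finsum_closed)
  have xp: "x p \<in> carrier R" using x S by simp
  have "(\<Oplus>i\<in>H. a [^] i \<otimes> x i) = (\<Oplus>i\<in>H. a [^] Suc p \<otimes> (a [^] (i - Suc p) \<otimes> x i))"
  proof (intro finsum_cong')
    fix i assume i: "i \<in> H"
    then have "a [^] i = a [^] Suc p \<otimes> a [^] (i - Suc p)"
      using a by (subst nat_pow_mult) (auto simp: H_def simp del: nat_pow_Suc)
    then show "a [^] i \<otimes> x i = a [^] Suc p \<otimes> (a [^] (i - Suc p) \<otimes> x i)"
      using a x i by (simp add: m_assoc H_def del: nat_pow_Suc)
  qed (use a x in \<open>auto simp: H_def\<close>)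
  also have "\<dots> = a [^] Suc p \<otimes> z"
    unfolding z_def using a x fin by (subst finsum_rdistr) (auto simp: H_def Pi_def)
  finally have high: "(\<Oplus>i\<in>H. a [^] i \<otimes> x i) = a [^] Suc p \<otimes> z" .
  define l where "l = (\<Oplus>i\<in>L. a [^] i \<otimes> x i)"
  have l: "l \<in> I" unfolding l_def
    using a low fin by (intro finsum_in_ideal[OF I]) (auto simp: L_def intro: I.I_l_closed)
  have "(\<Oplus>i\<in>S. a [^] i \<otimes> x i) = a [^] p \<otimes> x p \<oplus> (\<Oplus>i\<in>L \<union> H. a [^] i \<otimes> x i)"
    unfolding S_eq using a x fin S by (subst finsum_insert) (auto simp: L_def H_def)
  also have "(\<Oplus>i\<in>L \<union> H. a [^] i \<otimes> x i) = l \<oplus> a [^] Suc p \<otimes> z"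
    unfolding l_def high[symmetric] using a x fin
    by (subst finsum_Un_disjoint) (auto simp: L_def H_def)
  finally have "a [^] p \<otimes> x p \<oplus> (l \<oplus> a [^] Suc p \<otimes> z) \<in> I" using dep by simp
  then have "(a [^] p \<otimes> x p \<oplus> (l \<oplus> a [^] Suc p \<otimes> z)) \<oplus> \<ominus> l \<in> I"
    using l by (rule I.a_closed[OF _ I.a_inv_closed])
  also have "(a [^] p \<otimes> x p \<oplus> (l \<oplus> a [^] Suc p \<otimes> z)) \<oplus> \<ominus> l = a [^] p \<otimes> x p \<oplus> a [^] Suc p \<otimes> z"
    using a xp z I.Icarr[OF l] by (simp add: a_ac r_neg r_neg1 r_neg2 del: nat_pow_Suc)
  finally have "(a [^] p \<otimes> x p \<oplus> a [^] Suc p \<otimes> z) \<otimes> d \<in> I" using d by (intro I.I_r_closed)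
  moreover have "a [^] p \<otimes> (\<one> \<ominus> x p \<otimes> d) \<in> I" using a d by (intro I.I_l_closed) auto
  \<comment> \<open>The added element of \<open>I\<close> replaces \<open>a^p x_p d\<close> by
    \<open>a^p\<close>.\<close>
  ultimately have "a [^] p \<otimes> (\<one> \<ominus> x p \<otimes> d) \<oplus> (a [^] p \<otimes> x p \<oplus> a [^] Suc p \<otimes> z) \<otimes> d \<in> I"
    by (intro I.a_closed)
  also have "a [^] p \<otimes> (\<one> \<ominus> x p \<otimes> d) \<oplus> (a [^] p \<otimes> x p \<oplus> a [^] Suc p \<otimes> z) \<otimes> d
      = a [^] p \<ominus> a [^] Suc p \<otimes> (\<ominus> (z \<otimes> d))"
    using a xp z d by (simp add: a_minus_def l_distr r_distr l_minus r_minus m_assoc a_assoc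
        r_neg1 r_neg2 del: nat_pow_Suc)
  finally show ?thesis using z d unfolding pow_absorbing_def by blast
qed

section \<open>From stable powers to regular nil cleanness\<close>

text \<open>Modulo zero the congruences are equations, and left multiplication by
  \<open>a^(t - s)\<close> carries them to all later exponents. A threshold is needed so that the
  right and left versions can be used at one common exponent.\<close>

lemma pow_absorbing_zero_iterate:
  assumes a: "a \<in> carrier R" and "pow_absorbing R a {\<zero>}"
  obtains s :: nat where "\<And>t u. s \<le> t \<Longrightarrow> \<exists>x\<in>carrier R. a [^] t = a [^] (t + u) \<otimes> x"
proof -
  obtain s x0 where x0: "x0 \<in> carrier R" "a [^] (s::nat) \<ominus> a [^] Suc s \<otimes> x0 \<in> {\<zero>}"
    using assms(2) by (auto simp: pow_absorbing_def)
  have "\<exists>x\<in>carrier R. a [^] t = a [^] (t + u) \<otimes> x" if "s \<le> t" for t u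
  proof -
    obtain x where x: "x \<in> carrier R" "a [^] s \<ominus> a [^] (s + u) \<otimes> x \<in> {\<zero>}"
      using pow_absorbing_iterate[OF zeroideal a x0] by blast
    then have "a [^] s = a [^] (s + u) \<otimes> x" using a by simp
    then have "a [^] (t - s) \<otimes> a [^] s = (a [^] (t - s) \<otimes> a [^] (s + u)) \<otimes> x"
      using a x by (simp add: m_assoc)
    then have "a [^] t = a [^] (t + u) \<otimes> x" using a that by (simp add: nat_pow_mult)
    then show ?thesis using x by blast
  qed
  then show ?thesis using that by blast
qed

lemma regularly_nil_clean_if_pow_absorbing:
  assumes right: "\<And>a. a \<in> carrier R \<Longrightarrow> pow_absorbing R a {\<zero>}"
    and left: "\<And>a. a \<in> carrier R \<Longrightarrow> pow_absorbing (opposite_ring R) a {\<zero>}"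
  shows "regularly_nil_clean p q R"
  unfolding regularly_nil_clean_def
proof
  fix a assume a: "a \<in> carrier R"
  show "\<exists>e\<in>idempotents R. (\<exists>r\<in>carrier R. e = a [^] p \<otimes> r \<otimes> a [^] q)
      \<and> a [^] p \<otimes> (\<one> \<ominus> e) \<otimes> a [^] q \<in> nilpotents R"
  proof (cases "p + q = 0")
    case True
    then show ?thesis
      by (intro bexI[of _ \<one>]) (auto simp: idempotents_def nilpotents_def a_minus_def r_neg
          intro!: bexI[of _ \<one>] exI[of _ "1::nat"])
  next
    case False
    interpret Op: ring "opposite_ring R" by (rule opposite_ring_is_ring)
    obtain s1 :: nat where s1: "\<And>t u. s1 \<le> t \<Longrightarrow> \<exists>x\<in>carrier R. a [^] t = a [^] (t + u) \<otimes> x"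
      using pow_absorbing_zero_iterate[OF a right[OF a]] by blast
    obtain s2 :: nat where s2: "\<And>t u. s2 \<le> t \<Longrightarrow> \<exists>y\<in>carrier R. a [^] t = y \<otimes> a [^] (t + u)"
      using Op.pow_absorbing_zero_iterate[of a] left a by auto
    \<comment> \<open>Beyond both thresholds, so that \<open>b\<close> is a right and a left
      multiple of \<open>b b\<close>, and at least \<open>p\<close> and \<open>q\<close>, so that
      \<open>a^p\<close> and \<open>a^q\<close> can be split off \<open>b\<close>.\<close>
    define t where "t = s1 + s2 + p + q"
    define b where "b = a [^] t"
    have b: "b \<in> carrier R" using a by (simp add: b_def)
    have ab: "a \<otimes> b = b \<otimes> a" using a by (simp add: b_def flip: nat_pow_Suc2)
    obtain x where x: "x \<in> carrier R" "b = b \<otimes> b \<otimes> x"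
      using s1[of t t] a by (auto simp: t_def b_def nat_pow_mult)
    obtain y where y: "y \<in> carrier R" "b = y \<otimes> (b \<otimes> b)"
      using s2[of t t] a by (auto simp: t_def b_def nat_pow_mult)
    define e where "e = b \<otimes> x"
    have ec: "e \<in> carrier R" using b x by (simp add: e_def)
    \<comment> \<open>The two descriptions \<open>b x\<close> and \<open>y b\<close> agree, as both
      equal \<open>y b b x\<close>. This makes \<open>e\<close> a two-sided identity for
      \<open>b\<close>.\<close>
    have "y \<otimes> b = y \<otimes> (b \<otimes> b \<otimes> x)" using x(2) by (rule arg_cong)
    also have "\<dots> = (y \<otimes> (b \<otimes> b)) \<otimes> x" using b x(1) y(1) by (simp add: m_assoc)
    also have "\<dots> = e" by (simp only: y(2)[symmetric] e_def)
    finally have e_left: "e = y \<otimes> b" by simp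
    have be: "b \<otimes> e = b" using b x by (simp add: e_def flip: m_assoc)
    have eb: "e \<otimes> b = b" using b y by (simp add: e_left m_assoc)
    have ee: "e \<otimes> e = e"
    proof -
      have "e \<otimes> e = (e \<otimes> b) \<otimes> x" using ec b x by (simp add: e_def m_assoc)
      then show ?thesis by (simp only: eb e_def[symmetric])
    qed
    \<comment> \<open>\<open>e a\<close> and \<open>a e\<close> are both shown equal to
      \<open>e a e\<close>, using that \<open>a\<close> commutes with \<open>b\<close>.\<close>
    have "e \<otimes> a = y \<otimes> (a \<otimes> b)" using a b y by (simp add: e_left m_assoc ab)
    also have "\<dots> = y \<otimes> (a \<otimes> (b \<otimes> e))" by (simp add: be)
    also have "\<dots> = y \<otimes> (a \<otimes> b) \<otimes> e" using a b y ec by (simp add: m_assoc)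
    also have "\<dots> = e \<otimes> a \<otimes> e" using a b y by (simp add: e_left m_assoc ab)
    finally have eae: "e \<otimes> a = e \<otimes> a \<otimes> e" .
    have "a \<otimes> e = (a \<otimes> b) \<otimes> x" using a b x by (simp add: e_def m_assoc)
    also have "\<dots> = e \<otimes> (b \<otimes> a) \<otimes> x" using a b ec by (simp add: ab eb flip: m_assoc)
    also have "\<dots> = e \<otimes> a \<otimes> e" using a b x ec by (simp add: e_def m_assoc flip: ab)
    finally have ea: "e \<otimes> a = a \<otimes> e" using eae by simp
    \<comment> \<open>Writing \<open>e = e e\<close> with a different form in each factor puts
      \<open>b\<close> at both ends, hence \<open>a^p\<close> on the left and \<open>a^q\<close> on
      the right.\<close>
    have "e = (b \<otimes> x) \<otimes> (y \<otimes> b)" unfolding e_def[symmetric] e_left[symmetric] ee ..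
    also have "\<dots> = b \<otimes> (x \<otimes> y) \<otimes> b" using b x(1) y(1) by (simp add: m_assoc)
    also have "\<dots> = a [^] p \<otimes> (a [^] (t - p) \<otimes> (x \<otimes> y) \<otimes> a [^] (t - q)) \<otimes> a [^] q"
    proof -
      have "b = a [^] p \<otimes> a [^] (t - p)" "b = a [^] (t - q) \<otimes> a [^] q"
        using a by (simp_all add: b_def t_def nat_pow_mult add.assoc add.left_commute)
      then have "b \<otimes> (x \<otimes> y) \<otimes> b = a [^] p \<otimes> a [^] (t - p) \<otimes> (x \<otimes> y) \<otimes> (a [^] (t - q) \<otimes> a [^] q)"
        by metis
      then show ?thesis using a x y by (simp add: m_assoc)
    qed
    finally have mem: "\<exists>r\<in>carrier R. e = a [^] p \<otimes> r \<otimes> a [^] q"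
      using a x y by blast
    define f where "f = \<one> \<ominus> e"
    have fc: "f \<in> carrier R" using ec by (simp add: f_def)
    have af: "f \<otimes> a = a \<otimes> f"
      using a ec by (simp add: f_def a_minus_def l_distr r_distr l_minus r_minus ea)
    have fpow: "f \<otimes> a [^] j = a [^] j \<otimes> f" for j :: nat
    proof (induction j)
      case (Suc j)
      have "f \<otimes> a [^] Suc j = (f \<otimes> a [^] j) \<otimes> a" using a fc by (simp add: m_assoc)
      also have "\<dots> = a [^] j \<otimes> (f \<otimes> a)" using a fc Suc by (simp add: m_assoc)
      finally show ?case using a fc by (simp add: af m_assoc)
    qed (use fc in simp)
    have bf: "b \<otimes> f = \<zero>" using b ec by (simp add: f_def a_minus_def r_distr r_minus be r_neg)
    have c: "a [^] p \<otimes> f \<otimes> a [^] q = a [^] (p + q) \<otimes> f"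
      using a fc by (simp add: m_assoc fpow flip: nat_pow_mult)
    obtain j where j: "t = Suc j" using False by (cases t) (auto simp: t_def)
    \<comment> \<open>As \<open>p + q\<close> is positive, the \<open>t\<close>-th power of
      \<open>a^(p + q)\<close> still contains the factor \<open>b\<close>, which \<open>f\<close>
      annihilates.\<close>
    have "(p + q) * t = t + (p + q - 1) * t" using False by (cases "p + q") auto
    then have "(a [^] (p + q)) [^] t = a [^] ((p + q - 1) * t) \<otimes> b"
      using a by (simp add: nat_pow_pow b_def nat_pow_mult add.commute)
    moreover have "f [^] t = f \<otimes> f [^] j" unfolding j using fc by (rule nat_pow_Suc2)
    ultimately have "(a [^] (p + q) \<otimes> f) [^] t = a [^] ((p + q - 1) * t) \<otimes> (b \<otimes> f) \<otimes> f [^] j"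
      using a b fc by (subst pow_mult_distrib) (auto simp: fpow m_assoc)
    then have "(a [^] (p + q) \<otimes> f) [^] t = \<zero>" using a fc by (simp add: bf)
    then have "a [^] p \<otimes> f \<otimes> a [^] q \<in> nilpotents R"
      using a fc unfolding c by (auto simp: nilpotents_def)
    then show ?thesis using mem ec ee unfolding idempotents_def f_def by blast
  qed
qed

end


subsection \<open>Matrix rings\<close>

definition matrix_ideal :: "('a, 'b) ring_scheme \<Rightarrow> nat \<Rightarrow> 'a set \<Rightarrow> 'a mat set" where
  "matrix_ideal R k I = {A \<in> carrier (matrix_ring R k). \<forall>i<k. \<forall>j<k. A $$ (i, j) \<in> I}"

text \<open>Represents coefficients of linear dependences inside the matrix ring. It need not be
  central: left and right multiplication scale entries from different sides.\<close>

definition scalar_matrix :: "('a, 'b) ring_scheme \<Rightarrow> nat \<Rightarrow> 'a \<Rightarrow> 'a mat" where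
  "scalar_matrix R k c = mat k k (\<lambda>(i, j). if i = j then c else \<zero>\<^bsub>R\<^esub>)"

lemma matrix_ring_index:
  assumes "i < k" "j < k"
  shows "(A \<oplus>\<^bsub>matrix_ring R k\<^esub> B) $$ (i, j) = A $$ (i, j) \<oplus>\<^bsub>R\<^esub> B $$ (i, j)"
    "(A \<otimes>\<^bsub>matrix_ring R k\<^esub> B) $$ (i, j) = (\<Oplus>\<^bsub>R\<^esub>l\<in>{..<k}. A $$ (i, l) \<otimes>\<^bsub>R\<^esub> B $$ (l, j))"
    "\<zero>\<^bsub>matrix_ring R k\<^esub> $$ (i, j) = \<zero>\<^bsub>R\<^esub>"
    "\<one>\<^bsub>matrix_ring R k\<^esub> $$ (i, j) = (if i = j then \<one>\<^bsub>R\<^esub> else \<zero>\<^bsub>R\<^esub>)"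
    "scalar_matrix R k c $$ (i, j) = (if i = j then c else \<zero>\<^bsub>R\<^esub>)"
  using assms by (simp_all add: matrix_ring_def scalar_matrix_def)

lemma matrix_ring_carrier_index:
  assumes "A \<in> carrier (matrix_ring R k)" "i < k" "j < k"
  shows "A $$ (i, j) \<in> carrier R"
  using assms by (simp add: matrix_ring_carrier_iff)

lemma matrix_ring_eqI:
  assumes "A \<in> carrier (matrix_ring R k)" "B \<in> carrier (matrix_ring R k)"
    and "\<And>i j. i < k \<Longrightarrow> j < k \<Longrightarrow> A $$ (i, j) = B $$ (i, j)"
  shows "A = B"
  using assms by (intro eq_matI) (auto simp: matrix_ring_carrier_iff)

lemma scalar_matrix_closed:
  assumes "ring R" "c \<in> carrier R"
  shows "scalar_matrix R k c \<in> carrier (matrix_ring R k)"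
  using assms by (simp add: matrix_ring_carrier_iff scalar_matrix_def ring.ring_simprules)

context ring
begin

lemma matrix_ring_a_inv_index:
  assumes A: "A \<in> carrier (matrix_ring R k)" and ij: "i < k" "j < k"
  shows "(\<ominus>\<^bsub>matrix_ring R k\<^esub> A) $$ (i, j) = \<ominus> (A $$ (i, j))"
proof -
  interpret M: ring "matrix_ring R k" by (rule matrix_ring_is_ring)
  have "(\<ominus>\<^bsub>matrix_ring R k\<^esub> A \<oplus>\<^bsub>matrix_ring R k\<^esub> A) $$ (i, j) = \<zero>"
    using A ij by (simp add: M.l_neg matrix_ring_index(3))
  then have "(\<ominus>\<^bsub>matrix_ring R k\<^esub> A) $$ (i, j) \<oplus> A $$ (i, j) = \<zero>"
    using ij by (simp add: matrix_ring_index(1))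
  then show ?thesis
    using A ij M.a_inv_closed[OF A] by (intro minus_equality[symmetric]) (auto simp: matrix_ring_carrier_iff)
qed

lemma matrix_ring_minus_index:
  assumes "A \<in> carrier (matrix_ring R k)" "B \<in> carrier (matrix_ring R k)" "i < k" "j < k"
  shows "(A \<ominus>\<^bsub>matrix_ring R k\<^esub> B) $$ (i, j) = A $$ (i, j) \<ominus> B $$ (i, j)"
  using assms by (simp add: a_minus_def matrix_ring_index matrix_ring_a_inv_index)

lemma matrix_ring_finsum_index:
  assumes "finite S" "\<And>s. s \<in> S \<Longrightarrow> F s \<in> carrier (matrix_ring R k)" and ij: "i < k" "j < k"
  shows "finsum (matrix_ring R k) F S $$ (i, j) = (\<Oplus>s\<in>S. F s $$ (i, j))"
  using assms(1,2)
proof (induction S rule: finite_induct)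
  interpret M: ring "matrix_ring R k" by (rule matrix_ring_is_ring)
  {
    case empty
    then show ?case using ij by (simp add: matrix_ring_index)
  next
    case (insert s S)
    then show ?case using ij
      by (subst finsum_insert)
        (auto simp: M.finsum_insert Pi_def matrix_ring_index intro: matrix_ring_carrier_index)
  }
qed

lemma scalar_matrix_mult_index:
  assumes A: "A \<in> carrier (matrix_ring R k)" and c: "c \<in> carrier R" and ij: "i < k" "j < k"
  shows "(scalar_matrix R k c \<otimes>\<^bsub>matrix_ring R k\<^esub> A) $$ (i, j) = c \<otimes> A $$ (i, j)"
    and "(A \<otimes>\<^bsub>matrix_ring R k\<^esub> scalar_matrix R k c) $$ (i, j) = A $$ (i, j) \<otimes> c"
proof -
  have "(scalar_matrix R k c \<otimes>\<^bsub>matrix_ring R k\<^esub> A) $$ (i, j)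
      = (\<Oplus>l\<in>{..<k}. if i = l then c \<otimes> A $$ (l, j) else \<zero>)"
    using assms unfolding matrix_ring_index(2)[OF ij]
    by (intro finsum_cong') (auto simp: matrix_ring_index matrix_ring_carrier_index)
  also have "\<dots> = c \<otimes> A $$ (i, j)"
    using assms by (intro finsum_singleton) (auto simp: matrix_ring_carrier_index)
  finally show "(scalar_matrix R k c \<otimes>\<^bsub>matrix_ring R k\<^esub> A) $$ (i, j) = c \<otimes> A $$ (i, j)" .
  have "(A \<otimes>\<^bsub>matrix_ring R k\<^esub> scalar_matrix R k c) $$ (i, j)
      = (\<Oplus>l\<in>{..<k}. if j = l then A $$ (i, l) \<otimes> c else \<zero>)"
    using assms unfolding matrix_ring_index(2)[OF ij]
    by (intro finsum_cong') (auto simp: matrix_ring_index matrix_ring_carrier_index)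
  also have "\<dots> = A $$ (i, j) \<otimes> c"
    using assms by (intro finsum_singleton) (auto simp: matrix_ring_carrier_index)
  finally show "(A \<otimes>\<^bsub>matrix_ring R k\<^esub> scalar_matrix R k c) $$ (i, j) = A $$ (i, j) \<otimes> c" .
qed

lemma matrix_ideal_is_ideal:
  assumes I: "ideal I R"
  shows "ideal (matrix_ideal R k I) (matrix_ring R k)"
proof (rule idealI)
  interpret M: ring "matrix_ring R k" by (rule matrix_ring_is_ring)
  interpret I: ideal I R by fact
  show "subgroup (matrix_ideal R k I) (add_monoid (matrix_ring R k))"
  proof (rule M.add.subgroupI)
    have "\<zero>\<^bsub>matrix_ring R k\<^esub> \<in> matrix_ideal R k I"
      by (simp add: matrix_ideal_def matrix_ring_index)
    then show "matrix_ideal R k I \<noteq> {}" by blast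
  qed (auto simp: matrix_ideal_def matrix_ring_index matrix_ring_a_inv_index)
  fix A B assume A: "A \<in> matrix_ideal R k I" and B: "B \<in> carrier (matrix_ring R k)"
  show "A \<otimes>\<^bsub>matrix_ring R k\<^esub> B \<in> matrix_ideal R k I"
    using A B by (auto simp: matrix_ideal_def matrix_ring_index matrix_ring_carrier_index
        intro!: finsum_in_ideal[OF I] I.I_r_closed)
  show "B \<otimes>\<^bsub>matrix_ring R k\<^esub> A \<in> matrix_ideal R k I"
    using A B by (auto simp: matrix_ideal_def matrix_ring_index matrix_ring_carrier_index
        intro!: finsum_in_ideal[OF I] I.I_l_closed)
qed (rule matrix_ring_is_ring)

text \<open>Entries of a matrix product are sums of products of entries, so an inclusion between
  products of ideals of \<open>R\<close> carries over to the matrix ideals.\<close>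

lemma matrix_ideal_mult:
  assumes "ideal K R" and "\<And>x y. x \<in> I \<Longrightarrow> y \<in> J \<Longrightarrow> x \<otimes> y \<in> K"
    and A: "A \<in> matrix_ideal R k I" and B: "B \<in> matrix_ideal R k J"
  shows "A \<otimes>\<^bsub>matrix_ring R k\<^esub> B \<in> matrix_ideal R k K"
proof -
  interpret M: ring "matrix_ring R k" by (rule matrix_ring_is_ring)
  show ?thesis
    using A B M.m_closed[of A B]
    by (auto simp: matrix_ideal_def matrix_ring_index intro!: finsum_in_ideal[OF assms(1)] assms(2))
qed

lemma scalar_matrix_in_matrix_ideal:
  assumes "ideal I R" "c \<in> I"
  shows "scalar_matrix R k c \<in> matrix_ideal R k I"
proof -
  interpret I: ideal I R by fact
  show ?thesis
    using assms scalar_matrix_closed[OF ring_axioms]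
    by (auto simp: matrix_ideal_def matrix_ring_index)
qed

lemma one_minus_scalar_matrix_mult:
  assumes "c \<in> carrier R" "d \<in> carrier R"
  shows "\<one>\<^bsub>matrix_ring R k\<^esub> \<ominus>\<^bsub>matrix_ring R k\<^esub>
      scalar_matrix R k c \<otimes>\<^bsub>matrix_ring R k\<^esub> scalar_matrix R k d
    = scalar_matrix R k (\<one> \<ominus> c \<otimes> d)"
proof -
  interpret M: ring "matrix_ring R k" by (rule matrix_ring_is_ring)
  note closed = scalar_matrix_closed[OF ring_axioms]
  show ?thesis
    using assms
    by (intro matrix_ring_eqI)
      (auto simp: closed matrix_ring_minus_index scalar_matrix_mult_index
        matrix_ring_index(4,5) a_minus_def[of R])
qed

section \<open>Stable powers of matrices\<close>

lemma matrix_pow_absorbing_mod: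
  assumes P: "ideal P R" and one: "\<one> \<notin> P"
    and inverse: "\<And>a. a \<in> carrier R - P \<Longrightarrow>
      \<exists>b\<in>carrier R. \<one> \<ominus> a \<otimes> b \<in> P \<and> \<one> \<ominus> b \<otimes> a \<in> P"
    and A: "A \<in> carrier (matrix_ring R k)"
  shows "pow_absorbing (matrix_ring R k) A (matrix_ideal R k P)"
    and "pow_absorbing (opposite_ring (matrix_ring R k)) A (matrix_ideal R k P)"
proof -
  let ?M = "matrix_ring R k"
  \<comment> \<open>The index set \<open>{..k * k}\<close> includes its upper end: it has one
    element more than there are matrix positions, which forces a dependence.\<close>
  let ?S = "{..k * k}" and ?T = "{..<k} \<times> {..<k}"
  let ?D = "scalar_matrix R k"
  interpret M: ring ?M by (rule matrix_ring_is_ring)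
  interpret MOp: ring "opposite_ring ?M" by (rule M.opposite_ring_is_ring)
  interpret Op: ring "opposite_ring R" by (rule opposite_ring_is_ring)
  define v where "v i t = (A [^]\<^bsub>?M\<^esub> i) $$ t" for i :: nat and t
  have v: "v i t \<in> carrier R" if "t \<in> ?T" for i t
    using that A by (auto simp: v_def intro!: matrix_ring_carrier_index)
  note D = scalar_matrix_closed[OF ring_axioms]
  note DP = scalar_matrix_in_matrix_ideal[OF P]
  \<comment> \<open>The lowest power whose coefficient is nonzero modulo \<open>P\<close>; all
    earlier coefficients then lie in \<open>P\<close>.\<close>
  have first: "\<exists>p\<in>?S. c p \<notin> P \<and> (\<forall>i\<in>?S. i < p \<longrightarrow> c i \<in> P)"
    if ex: "\<exists>i\<in>?S. c i \<notin> P" for c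
    using ex exists_least_iff[of "\<lambda>i. i \<in> ?S \<and> c i \<notin> P"] by blast
  show "pow_absorbing ?M A (matrix_ideal R k P)"
  proof -
    \<comment> \<open>A cofactor on the right calls for coefficients on the right, so the
      elimination is run in the opposite of \<open>R\<close>.\<close>
    have "\<exists>c. (\<forall>i\<in>?S. c i \<in> carrier (opposite_ring R)) \<and> (\<exists>i\<in>?S. c i \<notin> P) \<and>
        (\<forall>t\<in>?T. (\<Oplus>\<^bsub>opposite_ring R\<^esub>i\<in>?S. c i \<otimes>\<^bsub>opposite_ring R\<^esub> v i t) \<in> P)"
    proof (rule Op.linear_dependence_mod[OF ideal_opposite_ring[OF P]])
      show "\<exists>b\<in>carrier (opposite_ring R).
          \<one>\<^bsub>opposite_ring R\<^esub> \<ominus>\<^bsub>opposite_ring R\<^esub> b \<otimes>\<^bsub>opposite_ring R\<^esub> a \<in> P"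
        if "a \<in> carrier (opposite_ring R) - P" for a
        using inverse[of a] that by auto
    qed (use one v in auto)
    then obtain c where c: "\<And>i. i \<in> ?S \<Longrightarrow> c i \<in> carrier R" "\<exists>i\<in>?S. c i \<notin> P"
      "\<And>t. t \<in> ?T \<Longrightarrow> (\<Oplus>i\<in>?S. v i t \<otimes> c i) \<in> P"
      by auto
    obtain p where p: "p \<in> ?S" "c p \<notin> P" "\<forall>i\<in>?S. i < p \<longrightarrow> c i \<in> P" using first[OF c(2)] by blast
    obtain d where d: "d \<in> carrier R" "\<one> \<ominus> c p \<otimes> d \<in> P" using inverse[of "c p"] c(1) p by blast
    show ?thesis
    proof (rule M.pow_absorbing_if_dependent[OF matrix_ideal_is_ideal[OF P] A _ p(1)])
      show "(\<Oplus>\<^bsub>?M\<^esub>i\<in>?S. A [^]\<^bsub>?M\<^esub> i \<otimes>\<^bsub>?M\<^esub> ?D (c i)) \<in> matrix_ideal R k P"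
      proof -
        have "(\<Oplus>\<^bsub>?M\<^esub>i\<in>?S. A [^]\<^bsub>?M\<^esub> i \<otimes>\<^bsub>?M\<^esub> ?D (c i)) $$ (a, b) = (\<Oplus>i\<in>?S. v i (a, b) \<otimes> c i)"
          if ab: "a < k" "b < k" for a b
          using ab A c D v by (subst matrix_ring_finsum_index)
            (auto intro!: finsum_cong' simp: scalar_matrix_mult_index v_def)
        then show ?thesis
          using A c D by (auto simp: matrix_ideal_def intro!: M.finsum_closed)
      qed
      show "\<one>\<^bsub>?M\<^esub> \<ominus>\<^bsub>?M\<^esub> ?D (c p) \<otimes>\<^bsub>?M\<^esub> ?D d \<in> matrix_ideal R k P"
        using c p d DP by (simp add: one_minus_scalar_matrix_mult)
    qed (use c p d D DP in auto)
  qed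
  show "pow_absorbing (opposite_ring ?M) A (matrix_ideal R k P)"
  proof -
    \<comment> \<open>Left coefficients come from \<open>R\<close> itself; here the passage to an
      opposite ring happens at the level of the matrix ring.\<close>
    have "\<exists>c. (\<forall>i\<in>?S. c i \<in> carrier R) \<and> (\<exists>i\<in>?S. c i \<notin> P) \<and>
        (\<forall>t\<in>?T. (\<Oplus>i\<in>?S. c i \<otimes> v i t) \<in> P)"
    proof (rule linear_dependence_mod[OF P one])
      show "\<exists>b\<in>carrier R. \<one> \<ominus> b \<otimes> a \<in> P" if "a \<in> carrier R - P" for a
        using inverse[OF that] by blast
    qed (use v in auto)
    then obtain c where c: "\<And>i. i \<in> ?S \<Longrightarrow> c i \<in> carrier R" "\<exists>i\<in>?S. c i \<notin> P"
      "\<And>t. t \<in> ?T \<Longrightarrow> (\<Oplus>i\<in>?S. c i \<otimes> v i t) \<in> P"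
      by auto
    obtain p where p: "p \<in> ?S" "c p \<notin> P" "\<forall>i\<in>?S. i < p \<longrightarrow> c i \<in> P" using first[OF c(2)] by blast
    obtain d where d: "d \<in> carrier R" "\<one> \<ominus> d \<otimes> c p \<in> P" using inverse[of "c p"] c(1) p by blast
    show ?thesis
    proof (rule MOp.pow_absorbing_if_dependent[OF M.ideal_opposite_ring[OF matrix_ideal_is_ideal[OF P]] _ _ p(1)])
      have "(\<Oplus>\<^bsub>?M\<^esub>i\<in>?S. ?D (c i) \<otimes>\<^bsub>?M\<^esub> A [^]\<^bsub>?M\<^esub> i) \<in> matrix_ideal R k P"
      proof -
        have "(\<Oplus>\<^bsub>?M\<^esub>i\<in>?S. ?D (c i) \<otimes>\<^bsub>?M\<^esub> A [^]\<^bsub>?M\<^esub> i) $$ (a, b) = (\<Oplus>i\<in>?S. c i \<otimes> v i (a, b))"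
          if ab: "a < k" "b < k" for a b
          using ab A c D v by (subst matrix_ring_finsum_index)
            (auto intro!: finsum_cong' simp: scalar_matrix_mult_index v_def)
        then show ?thesis
          using A c D by (auto simp: matrix_ideal_def intro!: M.finsum_closed)
      qed
      then show "(\<Oplus>\<^bsub>opposite_ring ?M\<^esub>i\<in>?S. A [^]\<^bsub>opposite_ring ?M\<^esub> i \<otimes>\<^bsub>opposite_ring ?M\<^esub> ?D (c i))
          \<in> matrix_ideal R k P"
        using A by simp
      have "\<one>\<^bsub>?M\<^esub> \<ominus>\<^bsub>?M\<^esub> ?D d \<otimes>\<^bsub>?M\<^esub> ?D (c p) \<in> matrix_ideal R k P"
        using c p d DP by (simp add: one_minus_scalar_matrix_mult)
      then show "\<one>\<^bsub>opposite_ring ?M\<^esub> \<ominus>\<^bsub>opposite_ring ?M\<^esub> ?D (c p) \<otimes>\<^bsub>opposite_ring ?M\<^esub> ?D d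
          \<in> matrix_ideal R k P"
        by simp
    qed (use A c p d D DP in auto)
  qed
qed

text \<open>The Zorn argument runs over ideals of \<open>R\<close>, through their matrix ideals, so
  prime ideals of the matrix ring never enter. \<open>Q\<close> joins both sides so that one prime
  ideal refutes a failure on either.\<close>

lemma matrix_pow_absorbing:
  assumes inverse: "\<And>P a. nc_prime_ideal P R \<Longrightarrow> a \<in> carrier R - P \<Longrightarrow>
      \<exists>b\<in>carrier R. \<one> \<ominus> a \<otimes> b \<in> P \<and> \<one> \<ominus> b \<otimes> a \<in> P"
    and A: "A \<in> carrier (matrix_ring R k)"
  shows "pow_absorbing (matrix_ring R k) A {\<zero>\<^bsub>matrix_ring R k\<^esub>} \<and>
    pow_absorbing (opposite_ring (matrix_ring R k)) A {\<zero>\<^bsub>matrix_ring R k\<^esub>}"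
proof -
  let ?M = "matrix_ring R k"
  interpret M: ring ?M by (rule matrix_ring_is_ring)
  interpret MOp: ring "opposite_ring ?M" by (rule M.opposite_ring_is_ring)
  define Q where "Q I \<longleftrightarrow> pow_absorbing ?M A (matrix_ideal R k I) \<and>
    pow_absorbing (opposite_ring ?M) A (matrix_ideal R k I)" for I
  have "Q {\<zero>}"
  proof (rule ccontr)
    assume "\<not> Q {\<zero>}"
    then obtain P where P: "nc_prime_ideal P R" "\<not> Q P"
    proof (rule obtain_nc_prime_ideal)
      have "matrix_ideal R k (carrier R) = carrier ?M"
        by (auto simp: matrix_ideal_def matrix_ring_carrier_index)
      then show "Q (carrier R)"
        using A by (auto simp: Q_def pow_absorbing_def)
    next
      fix C assume C: "C \<noteq> {}" "subset.chain {I. ideal I R} C" "Q (\<Union>C)"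
      obtain t X where X: "X \<in> carrier ?M"
        "A [^]\<^bsub>?M\<^esub> (t::nat) \<ominus>\<^bsub>?M\<^esub> A [^]\<^bsub>?M\<^esub> Suc t \<otimes>\<^bsub>?M\<^esub> X \<in> matrix_ideal R k (\<Union>C)" (is "?U \<in> _")
        using C(3) by (auto simp: Q_def pow_absorbing_def)
      obtain s Y where Y: "Y \<in> carrier (opposite_ring ?M)"
        "A [^]\<^bsub>opposite_ring ?M\<^esub> (s::nat) \<ominus>\<^bsub>opposite_ring ?M\<^esub>
          A [^]\<^bsub>opposite_ring ?M\<^esub> Suc s \<otimes>\<^bsub>opposite_ring ?M\<^esub> Y \<in> matrix_ideal R k (\<Union>C)" (is "?V \<in> _")
        using C(3) unfolding Q_def pow_absorbing_def by blast
      \<comment> \<open>Only the finitely many entries of the two error matrices must lie in an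
        ideal, so a single member of the chain contains them all and the same witnesses serve
        there.\<close>
      define E where "E = (\<lambda>ij. ?U $$ ij) ` ({..<k} \<times> {..<k}) \<union> (\<lambda>ij. ?V $$ ij) ` ({..<k} \<times> {..<k})"
      have "finite E" by (simp add: E_def)
      moreover have "E \<subseteq> \<Union>C" using X(2) Y(2) unfolding E_def matrix_ideal_def by blast
      ultimately obtain I where I: "I \<in> C" "E \<subseteq> I"
        using finite_subset_Union_chain C(1,2) by metis
      then have "?U \<in> matrix_ideal R k I" "?V \<in> matrix_ideal R k I"
        using X(2) Y(2) unfolding E_def matrix_ideal_def by blast+
      then have "Q I" using X(1) Y(1) unfolding Q_def pow_absorbing_def by blast
      then show "\<exists>I\<in>C. Q I" using I by blast
    next
      fix I J K assume ideals: "ideal I R" "ideal J R" "ideal K R" and "Q J" "Q K"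
        and prod: "\<And>x y. x \<in> J \<Longrightarrow> y \<in> K \<Longrightarrow> x \<otimes> y \<in> I"
      note mid = matrix_ideal_is_ideal[of _ k]
      have mult: "X \<otimes>\<^bsub>?M\<^esub> Y \<in> matrix_ideal R k I"
        if "X \<in> matrix_ideal R k J" "Y \<in> matrix_ideal R k K" for X Y
        using ideals(1) prod that by (rule matrix_ideal_mult)
      have "pow_absorbing ?M A (matrix_ideal R k I)"
      proof (rule M.pow_absorbing_product[OF mid[OF ideals(2)] mid[OF ideals(3)] A _ _ mult])
        show "pow_absorbing ?M A (matrix_ideal R k J)" "pow_absorbing ?M A (matrix_ideal R k K)"
          using \<open>Q J\<close> \<open>Q K\<close> by (simp_all add: Q_def)
      qed
      moreover have "pow_absorbing (opposite_ring ?M) A (matrix_ideal R k I)"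
      \<comment> \<open>Multiplication is reversed, so \<open>J\<close> and \<open>K\<close> trade
        places.\<close>
      proof (rule MOp.pow_absorbing_product[OF M.ideal_opposite_ring[OF mid[OF ideals(3)]]
            M.ideal_opposite_ring[OF mid[OF ideals(2)]]])
        show "A \<in> carrier (opposite_ring ?M)" using A by simp
        show "pow_absorbing (opposite_ring ?M) A (matrix_ideal R k J)"
          "pow_absorbing (opposite_ring ?M) A (matrix_ideal R k K)"
          using \<open>Q J\<close> \<open>Q K\<close> by (simp_all add: Q_def)
        show "X \<otimes>\<^bsub>opposite_ring ?M\<^esub> Y \<in> matrix_ideal R k I"
          if "X \<in> matrix_ideal R k K" "Y \<in> matrix_ideal R k J" for X Y
          using mult[OF that(2,1)] by simp
      qed
      ultimately show "Q I" by (simp add: Q_def)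
    qed
    have id: "ideal P R" using P by (simp add: nc_prime_ideal_def)
    have "\<one> \<notin> P" using P ideal.one_imp_carrier[OF id] by (auto simp: nc_prime_ideal_def)
    then have "Q P" using matrix_pow_absorbing_mod[OF id _ inverse[OF P(1)] A] by (auto simp: Q_def)
    then show False using P by simp
  qed
  moreover have "matrix_ideal R k {\<zero>} = {\<zero>\<^bsub>?M\<^esub>}"
    by (auto simp: matrix_ideal_def matrix_ring_index intro!: matrix_ring_eqI)
  ultimately show ?thesis by (simp add: Q_def)
qed

end

theorem theorem2p6:
  fixes R :: "('a, 'b) ring_scheme" and m n p q k :: nat
  assumes "ring R"
    and "(m, n) \<noteq> (0, 0)"
    and "two_primal R"
    and "regularly_nil_clean m n R"
    and "k > 0"
  shows "regularly_nil_clean p q (matrix_ring R k)"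
proof -
  interpret ring R by fact
  interpret M: ring "matrix_ring R k" by (rule matrix_ring_is_ring)
  have "pow_absorbing (matrix_ring R k) A {\<zero>\<^bsub>matrix_ring R k\<^esub>} \<and>
      pow_absorbing (opposite_ring (matrix_ring R k)) A {\<zero>\<^bsub>matrix_ring R k\<^esub>}"
    if "A \<in> carrier (matrix_ring R k)" for A
    by (intro matrix_pow_absorbing two_primal_regularly_nil_clean_inverse_mod[OF assms(3,4,2)] that)
  then show ?thesis by (intro M.regularly_nil_clean_if_pow_absorbing) auto
qed

end
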